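(* Let $\Phi$ be a quantum channel from a finite-dimensional system $A$ to a finite-dimensional system $A'$, each with a fixed reference basis. Then the complete cohering power and the generalized cohering power of $\Phi$, both with respect to the relative entropy of coherence $C_r$, coincide: $$\mathscr{C}_r(\Phi)=\mathfrak{C}_r(\Phi),$$ i.e. $$\sup_{\rho^{A}}\left\{C_r\left(\Phi[\rho^{A}]\right)-C_r(\rho^{A})\right\}=\sup_{k\ge 1}\ \sup_{\rho^{AB}}\left\{C_r\left(\Phi\otimes\mathbb{1}_k[\rho^{AB}]\right)-C_r(\rho^{AB})\right\},$$ where $\rho^A$ ranges over all states of $A$ and, for each $k$, $\rho^{AB}$ ranges over all states of $A\otimes B$ with $\dim B=k$.
   Context: All Hilbert spaces are finite-dimensional complex, and each system has a fixed orthonormal reference basis $\{|i\rangle\}$; for a bipartite system the reference basis is the product of the local reference bases. A state is a positive semidefinite operator of trace one; a quantum channel is a completely positive trace-preserving linear map. $S(\rho)=-\mathrm{Tr}[\rho\log_2\rho]$ is the von Neumann entropy and $\Delta[\rho]=\sum_i\langle i|\rho|i\rangle\,|i\rangle\langle i|$ is complete dephasing in the reference basis. The set $\mathcal{I}$ of incoherent states consists of the states diagonal in the reference basis. The relative entropy of coherence is $$C_r(\rho)=\min_{\sigma\in\mathcal{I}}S(\rho\|\sigma)=S(\Delta[\rho])-S(\rho),\qquad S(\rho\|\sigma)=\mathrm{Tr}[\rho\log_2\rho]-\mathrm{Tr}[\rho\log_2\sigma].$$ $\mathbb{1}_k$ denotes the identity channel on a system $B$ of dimension $k$. The generalized cohering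 power is $\mathscr{C}_r(\Phi)=\sup_\rho\{C_r(\Phi[\rho])-C_r(\rho)\}$ over all states $\rho$ of the input system. The complete cohering power is $\mathfrak{C}_r(\Phi)=\sup_k\sup_{\rho^{AB}}\{C_r(\Phi\otimes\mathbb{1}_k[\rho^{AB}])-C_r(\rho^{AB})\}$, where $k$ is the dimension of $B$. *)

theory Defs
  imports
    "Jordan_Normal_Form.Schur_Decomposition"
    "Jordan_Normal_Form.Matrix_Kernel"
    "HOL-Library.Extended_Real"
begin

text \<open>
  Operators are complex matrices with respect to the reference basis. For \<open>A \<otimes> B\<close> with
  \<open>dim B = k\<close>, the product basis vector \<open>|a\<rangle> \<otimes> |b\<rangle>\<close> has index \<open>a * k + b\<close>.
\<close>

definition mat_trace :: "complex mat \<Rightarrow> complex" where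
  "mat_trace A = (\<Sum>i<dim_row A. A $$ (i, i))"

text \<open>
  The order on \<^typ>\<open>complex\<close> makes \<open>0 \<le> z\<close> mean that \<open>z\<close> is real and nonnegative, so
  Hermiticity is implied.
\<close>

definition psd :: "nat \<Rightarrow> complex mat \<Rightarrow> bool" where
  "psd n A \<longleftrightarrow> A \<in> carrier_mat n n \<and> (\<forall>v \<in> carrier_vec n. 0 \<le> (A *\<^sub>v v) \<bullet>c v)"

definition states :: "nat \<Rightarrow> complex mat set" where
  "states n = {\<rho>. psd n \<rho> \<and> mat_trace \<rho> = 1}"

definition incoherent_states :: "nat \<Rightarrow> complex mat set" where
  "incoherent_states n = {\<rho> \<in> states n. diagonal_mat \<rho>}"

definition unitary_mat :: "nat \<Rightarrow> complex mat \<Rightarrow> bool" where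
  "unitary_mat n U \<longleftrightarrow> U \<in> carrier_mat n n \<and>
     U * mat_adjoint U = 1\<^sub>m n \<and> mat_adjoint U * U = 1\<^sub>m n"

definition spectral_fun_rel :: "(real \<Rightarrow> real) \<Rightarrow> complex mat \<Rightarrow> complex mat \<Rightarrow> bool" where
  "spectral_fun_rel f A B \<longleftrightarrow> (\<exists>n U d. unitary_mat n U \<and>
     A = U * mat_diag n (\<lambda>i. complex_of_real (d i)) * mat_adjoint U \<and>
     B = U * mat_diag n (\<lambda>i. complex_of_real (f (d i))) * mat_adjoint U)"

text \<open>\<open>B\<close> does not depend on the chosen diagonalization of \<open>A\<close>.\<close>

lemma spectral_fun_rel_unique:
  assumes "spectral_fun_rel f A B" "spectral_fun_rel f A C"
  shows "B = C"
proof -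
  obtain n U d where U: "unitary_mat n U"
    and A1: "A = U * mat_diag n (\<lambda>i. complex_of_real (d i)) * mat_adjoint U"
    and B: "B = U * mat_diag n (\<lambda>i. complex_of_real (f (d i))) * mat_adjoint U"
    using assms(1) unfolding spectral_fun_rel_def by blast
  obtain m V e where V': "unitary_mat m V"
    and A2': "A = V * mat_diag m (\<lambda>i. complex_of_real (e i)) * mat_adjoint V"
    and C': "C = V * mat_diag m (\<lambda>i. complex_of_real (f (e i))) * mat_adjoint V"
    using assms(2) unfolding spectral_fun_rel_def by blast
  have "dim_row A = n"
    using U unfolding A1 by (auto simp: unitary_mat_def)
  moreover have "dim_row A = m"
    using V' unfolding A2' by (auto simp: unitary_mat_def)
  ultimately have mn: "m = n" by simp
  note V = V'[unfolded mn] and A2 = A2'[unfolded mn] and C = C'[unfolded mn]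
  define Us Vs where "Us = mat_adjoint U" and "Vs = mat_adjoint V"
  have Uc: "U \<in> carrier_mat n n" and Vc: "V \<in> carrier_mat n n"
    using U V by (auto simp: unitary_mat_def)
  have Usc: "Us \<in> carrier_mat n n" and Vsc: "Vs \<in> carrier_mat n n"
    using Uc Vc by (auto simp: Us_def Vs_def mat_adjoint_def)
  have UU: "U * Us = 1\<^sub>m n" "Us * U = 1\<^sub>m n" and VV: "V * Vs = 1\<^sub>m n" "Vs * V = 1\<^sub>m n"
    using U V by (auto simp: unitary_mat_def Us_def Vs_def)
  define W where "W = Vs * U"
  have Wc: "W \<in> carrier_mat n n" using Vsc Uc by (simp add: W_def)
  have intertwine: "Vs * (U * D * Us) * U = W * D" "Vs * (V * D * Vs) * U = D * W"
    "V * (W * D) * Us = U * D * Us" "V * (D * W) * Us = V * D * Vs"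
    if Dc: "D \<in> carrier_mat n n" for D
  proof -
    note assoc = assoc_mult_mat[of _ n n _ n _ n]
    note cs = Uc Vc Usc Vsc Dc
    have l1: "U * (Us * X) = X" "Us * (U * X) = X" "V * (Vs * X) = X" "Vs * (V * X) = X"
      if "X \<in> carrier_mat n n" for X
      using that cs UU VV by (simp_all flip: assoc)
    show "Vs * (U * D * Us) * U = W * D" "Vs * (V * D * Vs) * U = D * W"
      "V * (W * D) * Us = U * D * Us" "V * (D * W) * Us = V * D * Vs"
      using cs UU VV l1 by (simp_all add: assoc W_def)
  qed
  let ?D = "\<lambda>h. mat_diag n (\<lambda>i. complex_of_real (h i))"
  have "W * ?D d = ?D e * W"
    using intertwine(1,2)[OF mat_diag_dim] A1 A2 unfolding Us_def Vs_def by metis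
  then have entry: "W $$ (i, j) * d j = e i * W $$ (i, j)" if "i < n" "j < n" for i j
    using that Wc mat_diag_mult_left[OF Wc] mat_diag_mult_right[OF Wc]
    by (auto dest!: arg_cong[where f = "\<lambda>M. M $$ (i, j)"])
  have "W * ?D (\<lambda>i. f (d i)) = ?D (\<lambda>i. f (e i)) * W"
    unfolding mat_diag_mult_left[OF Wc] mat_diag_mult_right[OF Wc]
  proof (rule cong_mat[OF refl refl])
    fix i j assume "i < n" "j < n"
    then have "W $$ (i, j) = 0 \<or> d j = e i" using entry by fastforce
    then show "(case (i, j) of (i, j) \<Rightarrow> W $$ (i, j) * complex_of_real (f (d j))) =
      (case (i, j) of (i, j) \<Rightarrow> complex_of_real (f (e i)) * W $$ (i, j))" by auto
  qed
  then show "B = C"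
    using intertwine(3,4)[OF mat_diag_dim] B C unfolding Us_def Vs_def by metis
qed

definition spectral_fun :: "(real \<Rightarrow> real) \<Rightarrow> complex mat \<Rightarrow> complex mat" where
  "spectral_fun f A = (THE B. spectral_fun_rel f A B)"

text \<open>The logarithm is taken on the support and is \<open>0\<close> on the kernel (\<open>0 log 0 = 0\<close>).\<close>

definition mat_log2 :: "complex mat \<Rightarrow> complex mat" where
  "mat_log2 = spectral_fun (\<lambda>x. if x = 0 then 0 else log 2 x)"

text \<open>For positive semidefinite matrices, \<open>supp \<rho> \<subseteq> supp \<sigma>\<close> iff \<open>ker \<sigma> \<subseteq> ker \<rho>\<close>.\<close>

definition rel_entropy :: "complex mat \<Rightarrow> complex mat \<Rightarrow> ereal" where
  "rel_entropy \<rho> \<sigma> =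
     (if mat_kernel \<sigma> \<subseteq> mat_kernel \<rho>
      then ereal (Re (mat_trace (\<rho> * mat_log2 \<rho>) - mat_trace (\<rho> * mat_log2 \<sigma>)))
      else \<infinity>)"

definition rel_entropy_coherence :: "complex mat \<Rightarrow> ereal" where
  "rel_entropy_coherence \<rho> = (INF \<sigma> \<in> incoherent_states (dim_row \<rho>). rel_entropy \<rho> \<sigma>)"

definition linear_superop :: "nat \<Rightarrow> nat \<Rightarrow> (complex mat \<Rightarrow> complex mat) \<Rightarrow> bool" where
  "linear_superop m n \<Phi> \<longleftrightarrow>
     (\<forall>X \<in> carrier_mat m m. \<Phi> X \<in> carrier_mat n n) \<and>
     (\<forall>X \<in> carrier_mat m m. \<forall>Y \<in> carrier_mat m m. \<Phi> (X + Y) = \<Phi> X + \<Phi> Y) \<and>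
     (\<forall>c. \<forall>X \<in> carrier_mat m m. \<Phi> (c \<cdot>\<^sub>m X) = c \<cdot>\<^sub>m \<Phi> X)"

text \<open>The operator \<open>(1 \<otimes> \<langle>b|) M (1 \<otimes> |b'\<rangle>)\<close> on the first factor.\<close>

definition partial_block :: "nat \<Rightarrow> nat \<Rightarrow> complex mat \<Rightarrow> nat \<Rightarrow> nat \<Rightarrow> complex mat" where
  "partial_block m k M b b' = mat m m (\<lambda>(a, a'). M $$ (a * k + b, a' * k + b'))"

text \<open>
  \<open>\<Phi> \<otimes> 1\<^sub>k\<close>, for \<open>\<Phi>\<close> mapping \<open>m \<times> m\<close> to \<open>n \<times> n\<close> matrices:
  \<open>M = \<Sum>\<^sub>b\<^sub>,\<^sub>b\<^sub>' M\<^sub>b\<^sub>b\<^sub>' \<otimes> |b\<rangle>\<langle>b'|\<close> is sent to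
  \<open>\<Sum>\<^sub>b\<^sub>,\<^sub>b\<^sub>' \<Phi>(M\<^sub>b\<^sub>b\<^sub>') \<otimes> |b\<rangle>\<langle>b'|\<close>.
\<close>

definition tensor_id ::
  "nat \<Rightarrow> nat \<Rightarrow> nat \<Rightarrow> (complex mat \<Rightarrow> complex mat) \<Rightarrow> complex mat \<Rightarrow> complex mat" where
  "tensor_id m n k \<Phi> M = mat (n * k) (n * k)
     (\<lambda>(i, j). \<Phi> (partial_block m k M (i mod k) (j mod k)) $$ (i div k, j div k))"

definition kron :: "complex mat \<Rightarrow> complex mat \<Rightarrow> complex mat" where
  "kron X Y = mat (dim_row X * dim_row Y) (dim_col X * dim_col Y)
     (\<lambda>(i, j). X $$ (i div dim_row Y, j div dim_col Y) * Y $$ (i mod dim_row Y, j mod dim_col Y))"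

lemma tensor_id_kron:
  assumes lin: "linear_superop m n \<Phi>" and X: "X \<in> carrier_mat m m" and Y: "Y \<in> carrier_mat k k"
  shows "tensor_id m n k \<Phi> (kron X Y) = kron (\<Phi> X) Y"
proof -
  have \<Phi>X: "\<Phi> X \<in> carrier_mat n n" and sm: "\<And>c. \<Phi> (c \<cdot>\<^sub>m X) = c \<cdot>\<^sub>m \<Phi> X"
    using lin X by (auto simp: linear_superop_def)
  have idx: "a * k + b < m * k" if "a < m" "b < k" for a b
  proof -
    have "a * k + b < Suc a * k" using that by simp
    also have "\<dots> \<le> m * k" using that by (intro mult_le_mono1) simp
    finally show ?thesis .
  qed
  have blk: "partial_block m k (kron X Y) b b' = Y $$ (b, b') \<cdot>\<^sub>m X" if "b < k" "b' < k" for b b'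
    using X Y that by (intro eq_matI) (auto simp: partial_block_def kron_def idx)
  show ?thesis
  proof (rule eq_matI)
    fix i j assume "i < dim_row (kron (\<Phi> X) Y)" "j < dim_col (kron (\<Phi> X) Y)"
    then have ij: "i < n * k" "j < n * k" using \<Phi>X Y by (auto simp: kron_def)
    then have "0 < k" by (cases k) auto
    then show "tensor_id m n k \<Phi> (kron X Y) $$ (i, j) = kron (\<Phi> X) Y $$ (i, j)"
      using ij \<Phi>X Y blk[of "i mod k" "j mod k"]
      by (simp add: tensor_id_def kron_def[of "\<Phi> X"] sm less_mult_imp_div_less)
  qed (use \<Phi>X Y in \<open>auto simp: tensor_id_def kron_def\<close>)
qed

definition completely_positive :: "nat \<Rightarrow> nat \<Rightarrow> (complex mat \<Rightarrow> complex mat) \<Rightarrow> bool" where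
  "completely_positive m n \<Phi> \<longleftrightarrow>
     (\<forall>k\<ge>1. \<forall>X. psd (m * k) X \<longrightarrow> psd (n * k) (tensor_id m n k \<Phi> X))"

definition trace_preserving :: "nat \<Rightarrow> (complex mat \<Rightarrow> complex mat) \<Rightarrow> bool" where
  "trace_preserving m \<Phi> \<longleftrightarrow> (\<forall>X \<in> carrier_mat m m. mat_trace (\<Phi> X) = mat_trace X)"

definition quantum_channel :: "nat \<Rightarrow> nat \<Rightarrow> (complex mat \<Rightarrow> complex mat) \<Rightarrow> bool" where
  "quantum_channel m n \<Phi> \<longleftrightarrow>
     linear_superop m n \<Phi> \<and> completely_positive m n \<Phi> \<and> trace_preserving m \<Phi>"

definition generalized_cohering_power :: "nat \<Rightarrow> (complex mat \<Rightarrow> complex mat) \<Rightarrow> ereal" where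
  "generalized_cohering_power m \<Phi> =
     (SUP \<rho> \<in> states m. rel_entropy_coherence (\<Phi> \<rho>) - rel_entropy_coherence \<rho>)"

definition complete_cohering_power ::
  "nat \<Rightarrow> nat \<Rightarrow> (complex mat \<Rightarrow> complex mat) \<Rightarrow> ereal" where
  "complete_cohering_power m n \<Phi> =
     (SUP k \<in> {1..}. SUP \<rho> \<in> states (m * k).
        rel_entropy_coherence (tensor_id m n k \<Phi> \<rho>) - rel_entropy_coherence \<rho>)"

end

theory Submission
  imports Defs
begin

text \<open>
  Let \<open>\<sigma>\<close> be the state \<open>\<rho>\<close> of \<open>A \<otimes> B\<close> dephased on \<open>B\<close>. The coherence of \<open>\<rho>\<close> splits as
  \<open>C(\<rho>) = \<Sum>\<^sub>b C(\<rho>\<^sub>b) + S(\<rho> \<parallel> \<sigma>)\<close>, where \<open>\<rho>\<^sub>b\<close> are the (unnormalized) diagonal blocks of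
  \<open>\<rho>\<close> on \<open>A\<close>. The map \<open>\<Phi> \<otimes> 1\<close> acts blockwise and commutes with the dephasing, so by monotonicity
  of the relative entropy its coherence gain is at most \<open>\<Sum>\<^sub>b C(\<Phi>(\<rho>\<^sub>b)) - C(\<rho>\<^sub>b)\<close>. Since \<open>C\<close> is
  homogeneous, this is an average over \<open>b\<close> of the gains of \<open>\<Phi>\<close> on the states \<open>\<rho>\<^sub>b / Tr \<rho>\<^sub>b\<close>, one of
  which attains at least the average.

  Monotonicity of the relative entropy comes from an integral representation of the logarithm: for each
  \<open>t > 0\<close> the integrand is the maximum over \<open>X\<close> of
  \<open>2 Re Tr(\<rho> X) - Tr(\<sigma> X X\<^sup>\<dagger>) - t Tr(\<rho> X\<^sup>\<dagger> X)\<close>, which decreases under channels by the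
  Kadison--Schwarz inequality for the dual map.
\<close>

section \<open>Adjoint, trace and positive semidefinite matrices\<close>

text \<open>The obstacle is that \<open>\<rho>\<close> and its dephased partner
  \<open>\<sigma>\<close> need not commute and that \<open>\<sigma>\<close> may be singular. Both
  difficulties are met by putting the squared overlaps of the two eigenbases as weights on pairs of
  eigenvalues: traces become finite double sums, no superoperator is inverted, and the inclusion of
  the kernel of \<open>\<sigma>\<close> in that of \<open>\<rho>\<close> removes every term with the
  logarithm of 0. Dephasing provides this inclusion on the input and on the output.

  Complete positivity enters through ancillas: the Schwarz inequality uses one of dimension 2, and
  as it is applied to the extended channel, \<open>\<Phi>\<close> itself sees an ancilla of
  dimension \<open>k * 2\<close>. The integral over \<open>t\<close> is never formed; derivatives of
  explicit primitives are compared and \<open>t\<close> then tends to infinity. Blocks stay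
  unnormalized until the end, since a block of trace 0 has no normalized version.\<close>

lemma mat_adjoint_carrier [simp]: "A \<in> carrier_mat n m \<Longrightarrow> mat_adjoint A \<in> carrier_mat m n"
  by (auto simp: mat_adjoint_def)

lemma dim_mat_adjoint [simp]:
  "dim_row (mat_adjoint A) = dim_col A" "dim_col (mat_adjoint A) = dim_row A"
  by (auto simp: mat_adjoint_def)

lemma index_mat_adjoint [simp]:
  fixes A :: "complex mat"
  assumes "i < dim_col A" "j < dim_row A"
  shows "mat_adjoint A $$ (i, j) = cnj (A $$ (j, i))"
  using assms by (simp add: mat_adjoint_def mat_of_rows_def)

lemma index_mult_mat_sum:
  assumes "A \<in> carrier_mat n m" "B \<in> carrier_mat m l" "i < n" "j < l"
  shows "(A * B) $$ (i, j) = (\<Sum>k<m. A $$ (i, k) * B $$ (k, j))"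
  using assms by (auto simp: scalar_prod_def atLeast0LessThan intro!: sum.cong)

lemma mat_adjoint_mult:
  fixes A B :: "complex mat"
  assumes "A \<in> carrier_mat n m" "B \<in> carrier_mat m l"
  shows "mat_adjoint (A * B) = mat_adjoint B * mat_adjoint A"
proof (rule eq_matI)
  fix i j assume "i < dim_row (mat_adjoint B * mat_adjoint A)" "j < dim_col (mat_adjoint B * mat_adjoint A)"
  then have ij: "i < l" "j < n" using assms by auto
  have "mat_adjoint (A * B) $$ (i, j) = cnj (\<Sum>k<m. A $$ (j, k) * B $$ (k, i))"
    using assms ij index_mult_mat_sum[OF assms ij(2,1)] by (simp del: index_mult_mat(1))
  also have "\<dots> = (\<Sum>k<m. mat_adjoint B $$ (i, k) * mat_adjoint A $$ (k, j))"
    using assms ij by (simp add: mult.commute)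
  also have "\<dots> = (mat_adjoint B * mat_adjoint A) $$ (i, j)"
    using assms ij by (subst index_mult_mat_sum[of _ l m _ n]) auto
  finally show "mat_adjoint (A * B) $$ (i, j) = (mat_adjoint B * mat_adjoint A) $$ (i, j)" .
qed (use assms in auto)

lemma mat_adjoint_adjoint [simp]: "mat_adjoint (mat_adjoint A) = (A :: complex mat)"
  by (rule eq_matI) auto

lemma mat_adjoint_one [simp]: "mat_adjoint (1\<^sub>m n) = (1\<^sub>m n :: complex mat)"
  by (rule eq_matI) auto

lemma mat_trace_mult:
  assumes "A \<in> carrier_mat n m" "B \<in> carrier_mat m n"
  shows "mat_trace (A * B) = (\<Sum>i<n. \<Sum>j<m. A $$ (i, j) * B $$ (j, i))"
  using assms by (auto simp: mat_trace_def scalar_prod_def atLeast0LessThan intro!: sum.cong)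

lemma mat_trace_comm:
  assumes "A \<in> carrier_mat n m" "B \<in> carrier_mat m n"
  shows "mat_trace (A * B) = mat_trace (B * A)"
  unfolding mat_trace_mult[OF assms] mat_trace_mult[OF assms(2,1)]
  by (subst sum.swap) (simp add: mult.commute)

lemma mat_trace_adjoint:
  "A \<in> carrier_mat n n \<Longrightarrow> mat_trace (mat_adjoint A) = cnj (mat_trace A)"
  by (auto simp: mat_trace_def)

lemma mat_trace_add:
  "A \<in> carrier_mat n n \<Longrightarrow> B \<in> carrier_mat n n \<Longrightarrow> mat_trace (A + B) = mat_trace A + mat_trace B"
  by (auto simp: mat_trace_def sum.distrib)

lemma mat_trace_smult: "A \<in> carrier_mat n n \<Longrightarrow> mat_trace (c \<cdot>\<^sub>m A) = c * mat_trace A"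
  by (auto simp: mat_trace_def sum_distrib_left)

text \<open>The vector is a plain function of which only the values below \<open>n\<close> are read,
  so test vectors supported on a block can be written with \<open>if\<close> and need no carrier
  conditions.\<close>

definition quad_form :: "nat \<Rightarrow> complex mat \<Rightarrow> (nat \<Rightarrow> complex) \<Rightarrow> complex" where
  "quad_form n A v = (\<Sum>i<n. \<Sum>j<n. cnj (v i) * A $$ (i, j) * v j)"

lemma quad_form_vec:
  assumes "A \<in> carrier_mat n n" "v \<in> carrier_vec n"
  shows "(A *\<^sub>v v) \<bullet>c v = quad_form n A (\<lambda>i. v $ i)"
  using assms
  by (auto simp: quad_form_def scalar_prod_def atLeast0LessThan sum_distrib_right sum_distrib_left
      intro!: sum.cong)

lemma quad_form_cong: "(\<And>i. i < n \<Longrightarrow> v i = w i) \<Longrightarrow> quad_form n A v = quad_form n A w"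
  by (auto simp: quad_form_def intro!: sum.cong)

lemma psd_iff_quad_form: "psd n A \<longleftrightarrow> A \<in> carrier_mat n n \<and> (\<forall>v. 0 \<le> quad_form n A v)"
proof safe
  assume *: "psd n A"
  show "A \<in> carrier_mat n n" using * by (simp add: psd_def)
  fix v
  have "0 \<le> (A *\<^sub>v vec n v) \<bullet>c vec n v" using * by (simp add: psd_def)
  also have "\<dots> = quad_form n A (\<lambda>i. vec n v $ i)"
    using * by (intro quad_form_vec) (auto simp: psd_def)
  also have "\<dots> = quad_form n A v" by (rule quad_form_cong) auto
  finally show "0 \<le> quad_form n A v" .
qed (auto simp: psd_def quad_form_vec)

lemma psd_carrier: "psd n A \<Longrightarrow> A \<in> carrier_mat n n"
  by (simp add: psd_def)

lemma quad_form_conj: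
  assumes "A \<in> carrier_mat n n" "B \<in> carrier_mat n m"
  shows "quad_form m (mat_adjoint B * A * B) v = quad_form n A (\<lambda>i. \<Sum>j<m. B $$ (i, j) * v j)"
proof -
  have AB: "mat_adjoint B * A \<in> carrier_mat m n" using assms by auto
  have "quad_form m (mat_adjoint B * A * B) v =
     (\<Sum>i<m. \<Sum>j<m. \<Sum>k<n. \<Sum>l<n. cnj (v i) * cnj (B $$ (l, i)) * A $$ (l, k) * B $$ (k, j) * v j)"
    unfolding quad_form_def
  proof (intro sum.cong refl)
    fix i j assume ij: "i \<in> {..<m}" "j \<in> {..<m}"
    have "(mat_adjoint B * A * B) $$ (i, j) =
        (\<Sum>k<n. (\<Sum>l<n. mat_adjoint B $$ (i, l) * A $$ (l, k)) * B $$ (k, j))"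
      using ij assms
      by (subst index_mult_mat_sum[OF AB assms(2)], simp, simp, intro sum.cong refl,
        subst index_mult_mat_sum[of _ m n _ n]) auto
    also have "\<dots> = (\<Sum>k<n. \<Sum>l<n. cnj (B $$ (l, i)) * A $$ (l, k) * B $$ (k, j))"
      using assms ij by (simp add: sum_distrib_right)
    finally show "cnj (v i) * (mat_adjoint B * A * B) $$ (i, j) * v j = (\<Sum>k<n. \<Sum>l<n.
       cnj (v i) * cnj (B $$ (l, i)) * A $$ (l, k) * B $$ (k, j) * v j)"
      by (simp add: sum_distrib_left sum_distrib_right mult.assoc)
  qed
  also have "\<dots> = (\<Sum>l<n. \<Sum>k<n. \<Sum>i<m. \<Sum>j<m. cnj (v i) * cnj (B $$ (l, i)) * A $$ (l, k) * B $$ (k, j) * v j)"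
    by (simp add: sum.swap[of _ "{..<n}" "{..<m}"]) (subst sum.swap, rule refl)
  also have "\<dots> = quad_form n A (\<lambda>i. \<Sum>j<m. B $$ (i, j) * v j)"
    unfolding quad_form_def
    by (intro sum.cong refl) (simp add: sum_distrib_left sum_distrib_right mult_ac)
  finally show ?thesis .
qed

lemma psd_conj:
  assumes "psd n A" "B \<in> carrier_mat n m"
  shows "psd m (mat_adjoint B * A * B)"
  using assms quad_form_conj[of A n B m] by (auto simp: psd_iff_quad_form)

lemma quad_form_support:
  assumes "S \<subseteq> {..<n}" "\<And>i. i < n \<Longrightarrow> i \<notin> S \<Longrightarrow> v i = 0"
  shows "quad_form n A v = (\<Sum>i\<in>S. \<Sum>j\<in>S. cnj (v i) * A $$ (i, j) * v j)"
proof -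
  have "(\<Sum>j<n. cnj (v i) * A $$ (i, j) * v j) = (\<Sum>j\<in>S. cnj (v i) * A $$ (i, j) * v j)" for i
    using assms by (intro sum.mono_neutral_right) auto
  moreover have "(\<Sum>i<n. \<Sum>j\<in>S. cnj (v i) * A $$ (i, j) * v j) = (\<Sum>i\<in>S. \<Sum>j\<in>S. cnj (v i) * A $$ (i, j) * v j)"
    using assms by (intro sum.mono_neutral_right) auto
  ultimately show ?thesis by (simp add: quad_form_def)
qed

lemma quad_form_unit:
  assumes "i < n"
  shows "quad_form n A (\<lambda>k. if k = i then 1 else 0) = A $$ (i, i)"
  using assms by (subst quad_form_support[of "{i}"]) auto

lemma psd_diag_nonneg: "psd n A \<Longrightarrow> i < n \<Longrightarrow> 0 \<le> A $$ (i, i)"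
  using quad_form_unit[of i n A] by (metis psd_iff_quad_form)

lemma psd_trace_nonneg: "psd n A \<Longrightarrow> 0 \<le> mat_trace A"
  using psd_diag_nonneg[of n A] psd_carrier[of n A]
  by (auto simp: mat_trace_def intro!: sum_nonneg)

lemma quad_form_pair:
  assumes "i < n" "j < n" "i \<noteq> j"
  shows "quad_form n A (\<lambda>k. if k = i then 1 else if k = j then c else 0) =
    A $$ (i, i) + A $$ (i, j) * c + cnj c * A $$ (j, i) + cnj c * A $$ (j, j) * c"
  using assms by (subst quad_form_support[of "{i, j}"]) auto

text \<open>Nonnegativity in the order of the complex numbers includes being real, and by
  polarization a form with only real values belongs to a Hermitian matrix.\<close>

lemma psd_hermitian:
  assumes "psd n A"
  shows "mat_adjoint A = A"
proof (rule eq_matI)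
  have A: "A \<in> carrier_mat n n" using assms by (rule psd_carrier)
  fix i j assume "i < dim_row A" "j < dim_col A"
  then have ij: "i < n" "j < n" using A by auto
  have diag: "Im (A $$ (k, k)) = 0" if "k < n" for k
    using psd_diag_nonneg[OF assms that] by (simp add: less_eq_complex_def)
  show "mat_adjoint A $$ (i, j) = A $$ (i, j)"
  proof (cases "i = j")
    case True
    then show ?thesis using A ij diag by (simp add: complex_eq_iff)
  next
    case False
    have "0 \<le> quad_form n A (\<lambda>k. if k = i then 1 else if k = j then c else 0)" for c
      using assms by (simp add: psd_iff_quad_form)
    then have "Im (A $$ (i, i) + A $$ (i, j) * c + cnj c * A $$ (j, i) + cnj c * A $$ (j, j) * c) = 0" for c
      unfolding quad_form_pair[OF ij False] by (simp add: less_eq_complex_def)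
    \<comment> \<open>\<open>c = 1\<close> compares the imaginary parts of the two off-diagonal
      entries, \<open>c = \<i>\<close> their real parts.\<close>
    from this[of 1] this[of \<i>] show ?thesis using A ij diag[of i] diag[of j] by (simp add: complex_eq_iff)
  qed
qed (use psd_carrier[OF assms] in auto)

section \<open>Spectral theorem\<close>

lemma mult_square_carrier [simp]:
  "A \<in> carrier_mat n n \<Longrightarrow> B \<in> carrier_mat n n \<Longrightarrow> A * B \<in> carrier_mat n n"
  by (rule mult_carrier_mat)

definition diagonalizes :: "nat \<Rightarrow> complex mat \<Rightarrow> (nat \<Rightarrow> real) \<Rightarrow> complex mat \<Rightarrow> bool" where
  "diagonalizes n U d A \<longleftrightarrow> unitary_mat n U \<and>
     A = U * mat_diag n (\<lambda>i. complex_of_real (d i)) * mat_adjoint U"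

lemma unitary_matD:
  assumes "unitary_mat n U"
  shows "U \<in> carrier_mat n n" "mat_adjoint U \<in> carrier_mat n n"
    "U * mat_adjoint U = 1\<^sub>m n" "mat_adjoint U * U = 1\<^sub>m n"
  using assms by (auto simp: unitary_mat_def)

lemma unitary_matI:
  assumes "U \<in> carrier_mat n n" "mat_adjoint U * U = 1\<^sub>m n"
  shows "unitary_mat n U"
  using assms mat_mult_left_right_inverse[of "mat_adjoint U" n U] by (auto simp: unitary_mat_def)

lemma unitary_cancel:
  assumes "unitary_mat n U" "X \<in> carrier_mat n m"
  shows "U * (mat_adjoint U * X) = X" "mat_adjoint U * (U * X) = X"
  using assms(2) unitary_matD[OF assms(1)]
    assoc_mult_mat[of U n n "mat_adjoint U" n X m]
    assoc_mult_mat[of "mat_adjoint U" n n U n X m]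
  by simp_all

lemma unitary_adjoint: "unitary_mat n U \<Longrightarrow> unitary_mat n (mat_adjoint U)"
  by (auto simp: unitary_mat_def)

lemma unitary_mult:
  assumes "unitary_mat n U" "unitary_mat n V"
  shows "unitary_mat n (U * V)"
proof (rule unitary_matI)
  note U = unitary_matD[OF assms(1)] and V = unitary_matD[OF assms(2)]
  show "U * V \<in> carrier_mat n n" using U V by simp
  show "mat_adjoint (U * V) * (U * V) = 1\<^sub>m n"
    using U V unitary_cancel(2)[OF assms(1) V(1)]
    by (simp add: mat_adjoint_mult[of _ n n _ n] assoc_mult_mat[of _ n n _ n _ n])
qed

lemma conj_mat_mult:
  fixes W U D :: "complex mat"
  assumes "W \<in> carrier_mat n n" "U \<in> carrier_mat n n" "D \<in> carrier_mat n n"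
  shows "W * (U * D * mat_adjoint U) * mat_adjoint W = W * U * D * mat_adjoint (W * U)"
  using assms by (simp add: mat_adjoint_mult[of _ n n _ n] assoc_mult_mat[of _ n n _ n _ n])

lemma index_diag_conj:
  assumes "U \<in> carrier_mat m n" "i < m" "j < m"
  shows "(U * mat_diag n d * mat_adjoint U) $$ (i, j) =
    (\<Sum>k<n. U $$ (i, k) * d k * cnj (U $$ (j, k)))"
proof -
  have "U * mat_diag n d = mat m n (\<lambda>(i, j). U $$ (i, j) * d j)"
    using assms by (simp add: mat_diag_mult_right)
  then show ?thesis
    using assms by (subst index_mult_mat_sum[of _ m n _ m]) auto
qed

text \<open>Gram-Schmidt, applied to a completion of \<open>v\<close> to a basis, leaves the head of
  the list alone. It orthogonalizes without normalizing, so each column is divided by its length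
  \<open>N j\<close> and the first is only a multiple of \<open>v\<close>.\<close>

lemma unitary_first_col:
  assumes v: "v \<in> carrier_vec n" and v0: "v \<noteq> 0\<^sub>v n"
  obtains W :: "complex mat" and c where "unitary_mat n W" "col W 0 = c \<cdot>\<^sub>v v"
proof -
  define b where "b = basis_completion v"
  define ws where "ws = gram_schmidt n b"
  note bc = vec_space.basis_completion[OF v v0, folded b_def]
  from bc have hdb: "hd b = v" and len_b: "length b = n" by auto
  have n: "n \<noteq> 0" using v v0 by (intro notI) auto
  from hdb len_b n obtain vs where bv: "b = v # vs" by (cases b) auto
  from cof_vec_space.gram_schmidt_result[OF bc(2,4,5) refl, folded ws_def]
  have ws: "set ws \<subseteq> carrier_vec n" "corthogonal ws" "length ws = n" by (auto simp: len_b)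
  from cof_vec_space.gram_schmidt_hd[OF v, of vs, folded bv] have hdws: "hd ws = v" unfolding ws_def .
  then have ws0: "ws ! 0 = v" using ws n by (cases ws) auto
  define N where "N j = complex_of_real (sqrt (Re (ws ! j \<bullet>c ws ! j)))" for j
  have wsj: "ws ! j \<in> carrier_vec n" if "j < n" for j using ws that by auto
  have NN: "cnj (N j) = N j" "N j * N j = ws ! j \<bullet>c ws ! j" "N j \<noteq> 0" if "j < n" for j
  proof -
    have "ws ! j \<bullet>c ws ! j \<noteq> 0" using corthogonalD[OF ws(2)] that ws(3) by auto
    moreover have "0 \<le> ws ! j \<bullet>c ws ! j" by (rule conjugate_square_ge_0_vec)
    ultimately show "cnj (N j) = N j" "N j * N j = ws ! j \<bullet>c ws ! j" "N j \<noteq> 0"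
      unfolding N_def by (auto simp: less_eq_complex_def complex_eq_iff simp flip: of_real_mult)
  qed
  define W where "W = mat n n (\<lambda>(i, j). ws ! j $ i / N j)"
  have W: "W \<in> carrier_mat n n" by (simp add: W_def)
  have "mat_adjoint W * W = 1\<^sub>m n"
  proof (rule eq_matI)
    fix i j assume "i < dim_row (1\<^sub>m n :: complex mat)" "j < dim_col (1\<^sub>m n :: complex mat)"
    then have ij: "i < n" "j < n" by auto
    have "(mat_adjoint W * W) $$ (i, j) = (\<Sum>k<n. cnj (W $$ (k, i)) * W $$ (k, j))"
      using W ij by (subst index_mult_mat_sum[of _ n n _ n]) auto
    also have "\<dots> = (\<Sum>k<n. ws ! j $ k * cnj (ws ! i $ k) / (N i * N j))"
      using ij NN by (intro sum.cong) (auto simp: W_def)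
    also have "\<dots> = (ws ! j \<bullet>c ws ! i) / (N i * N j)"
      using wsj[OF ij(1)] wsj[OF ij(2)]
      by (auto simp: scalar_prod_def atLeast0LessThan sum_divide_distrib)
    also have "\<dots> = 1\<^sub>m n $$ (i, j)"
      using ij NN corthogonalD[OF ws(2), of j i] ws(3) by auto
    finally show "(mat_adjoint W * W) $$ (i, j) = 1\<^sub>m n $$ (i, j)" .
  qed (use W in auto)
  then have "unitary_mat n W" using W by (intro unitary_matI)
  moreover have "col W 0 = (1 / N 0) \<cdot>\<^sub>v v"
    using n v by (intro eq_vecI) (auto simp: W_def ws0)
  ultimately show ?thesis by (rule that)
qed

lemma exists_eigenvector:
  fixes A :: "complex mat"
  assumes A: "A \<in> carrier_mat n n" and "0 < n"
  obtains v e where "v \<in> carrier_vec n" "v \<noteq> 0\<^sub>v n" "A *\<^sub>v v = e \<cdot>\<^sub>v v"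
proof -
  obtain as where as: "char_poly A = (\<Prod>a\<leftarrow>as. [:- a, 1:])" "length as = n"
    using char_poly_factorized[OF A] by blast
  obtain e bs where "as = e # bs" using as assms by (cases as) auto
  then have "poly (char_poly A) e = 0" by (simp add: as)
  then obtain v where "eigenvector A v e"
    using eigenvalue_root_char_poly[OF A] by (auto simp: eigenvalue_def)
  then show ?thesis using A that by (auto simp: eigenvector_def)
qed

text \<open>Deflation: in an orthonormal basis that starts with an eigenvector, the first column of
  the matrix vanishes below the diagonal, Hermiticity clears the first row as well, and the
  remaining block is Hermitian of size \<open>n\<close>.\<close>

theorem hermitian_diagonalizable:
  assumes "A \<in> carrier_mat n n" "mat_adjoint A = A"
  shows "\<exists>U d. diagonalizes n U d A"
  using assms
proof (induction n arbitrary: A)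
  case 0
  have "unitary_mat 0 (1\<^sub>m 0)" by (simp add: unitary_mat_def)
  moreover have "A = 1\<^sub>m 0 * mat_diag 0 (\<lambda>i. complex_of_real 0) * mat_adjoint (1\<^sub>m 0)"
    using 0 by (intro eq_matI) auto
  ultimately show ?case unfolding diagonalizes_def by (intro exI[of _ "1\<^sub>m 0"] exI[of _ "\<lambda>_. 0"]) simp
next
  case (Suc n)
  note A = Suc.prems
  obtain v e where v: "v \<in> carrier_vec (Suc n)" "v \<noteq> 0\<^sub>v (Suc n)" "A *\<^sub>v v = e \<cdot>\<^sub>v v"
    using exists_eigenvector[OF A(1)] by auto
  obtain W c where W: "unitary_mat (Suc n) W" and Wc: "col W 0 = c \<cdot>\<^sub>v v"
    using unitary_first_col[OF v(1,2)] by blast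
  note W' = unitary_matD[OF W]
  define B where "B = mat_adjoint W * A * W"
  have B: "B \<in> carrier_mat (Suc n) (Suc n)" using A W' by (simp add: B_def)
  have AB: "A = W * B * mat_adjoint W"
    using A W' unitary_cancel[OF W]
    by (simp add: B_def assoc_mult_mat[of _ "Suc n" "Suc n" _ "Suc n" _ "Suc n"])
  have Bh: "mat_adjoint B = B"
    using A W' by (simp add: B_def mat_adjoint_mult[of _ "Suc n" "Suc n" _ "Suc n"]
        assoc_mult_mat[of _ "Suc n" "Suc n" _ "Suc n" _ "Suc n"])
  have herm: "B $$ (i, j) = cnj (B $$ (j, i))" if "i < Suc n" "j < Suc n" for i j
    using B Bh that index_mat_adjoint[of i B j] by auto
  have col0: "B $$ (i, 0) = (if i = 0 then e else 0)" if "i < Suc n" for i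
  proof -
    have "A *\<^sub>v col W 0 = e \<cdot>\<^sub>v col W 0"
      using v A by (simp add: Wc mult_mat_vec smult_smult_assoc mult.commute)
    moreover have "col (A * W) 0 = A *\<^sub>v col W 0" by (rule col_mult2[OF A(1) W'(1)]) simp
    ultimately have AW: "col (A * W) 0 = e \<cdot>\<^sub>v col W 0" by (rule trans[rotated])
    have "B $$ (i, 0) = row (mat_adjoint W) i \<bullet> col (A * W) 0"
      using A W' that by (simp add: B_def assoc_mult_mat[of _ "Suc n" "Suc n" _ "Suc n" _ "Suc n"])
    also have "\<dots> = e * (mat_adjoint W * W) $$ (i, 0)"
      unfolding AW using W'(1,2) that by simp
    finally show ?thesis using W' that by simp
  qed
  have row0: "B $$ (0, i) = (if i = 0 then e else 0)" if "i < Suc n" for i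
    using herm[of 0 i] col0[of i] col0[of 0] herm[of 0 0] that by auto
  have e: "complex_of_real (Re e) = e"
    using herm[of 0 0] col0[of 0] by (simp add: complex_eq_iff)
  define B1 where "B1 = mat n n (\<lambda>(i, j). B $$ (Suc i, Suc j))"
  have "mat_adjoint B1 = B1"
    by (rule eq_matI) (auto simp: B1_def intro!: herm[symmetric])
  moreover have "B1 \<in> carrier_mat n n" by (simp add: B1_def)
  ultimately obtain U1 d1 where "diagonalizes n U1 d1 B1" using Suc.IH by blast
  then have U1: "unitary_mat n U1"
    and B1U: "B1 = U1 * mat_diag n (\<lambda>i. complex_of_real (d1 i)) * mat_adjoint U1"
    unfolding diagonalizes_def by (rule conjunct1, rule conjunct2)
  note U1' = unitary_matD[OF U1]
  \<comment> \<open>\<open>U\<close> is the direct sum of the 1 by 1 identity and \<open>U1\<close>;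
    correspondingly the eigenvalue \<open>e\<close> is put in front of \<open>d1\<close>.\<close>
  define U where "U = mat (Suc n) (Suc n) (\<lambda>(i, j).
    if i = 0 \<or> j = 0 then (if i = j then 1 else 0) else U1 $$ (i - 1, j - 1))"
  define d where "d i = (if i = 0 then Re e else d1 (i - 1))" for i
  have U: "U \<in> carrier_mat (Suc n) (Suc n)" by (simp add: U_def)
  have "mat_adjoint U * U = 1\<^sub>m (Suc n)"
  proof (rule eq_matI)
    fix i j assume "i < dim_row (1\<^sub>m (Suc n) :: complex mat)" "j < dim_col (1\<^sub>m (Suc n) :: complex mat)"
    then have ij: "i < Suc n" "j < Suc n" by auto
    have s: "(mat_adjoint U * U) $$ (i, j) =
        cnj (U $$ (0, i)) * U $$ (0, j) + (\<Sum>k<n. cnj (U $$ (Suc k, i)) * U $$ (Suc k, j))"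
      using U ij by (subst index_mult_mat_sum[of _ "Suc n" "Suc n" _ "Suc n"])
        (auto simp del: sum.lessThan_Suc simp: sum.lessThan_Suc_shift)
    show "(mat_adjoint U * U) $$ (i, j) = 1\<^sub>m (Suc n) $$ (i, j)"
    proof (cases "i = 0 \<or> j = 0")
      case True
      then show ?thesis unfolding s using ij by (auto simp: U_def)
    next
      case False
      then obtain i' j' where i'j': "i = Suc i'" "j = Suc j'" by (meson not0_implies_Suc)
      have "(\<Sum>k<n. cnj (U $$ (Suc k, i)) * U $$ (Suc k, j)) = (mat_adjoint U1 * U1) $$ (i', j')"
        using U1' i'j' ij by (subst index_mult_mat_sum[of _ n n _ n]) (auto simp: U_def)
      then show ?thesis unfolding s using U1' i'j' ij by (auto simp: U_def)
    qed
  qed (use U in auto)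
  then have Uu: "unitary_mat (Suc n) U" using U by (intro unitary_matI)
  let ?D = "mat_diag (Suc n) (\<lambda>i. complex_of_real (d i))"
  have "B = U * ?D * mat_adjoint U"
  proof (rule eq_matI)
    fix i j assume "i < dim_row (U * ?D * mat_adjoint U)" "j < dim_col (U * ?D * mat_adjoint U)"
    then have ij: "i < Suc n" "j < Suc n" using U by auto
    have s: "(U * ?D * mat_adjoint U) $$ (i, j) =
        U $$ (i, 0) * d 0 * cnj (U $$ (j, 0)) + (\<Sum>k<n. U $$ (i, Suc k) * d (Suc k) * cnj (U $$ (j, Suc k)))"
      using U ij by (subst index_diag_conj) (auto simp del: sum.lessThan_Suc simp: sum.lessThan_Suc_shift)
    show "B $$ (i, j) = (U * ?D * mat_adjoint U) $$ (i, j)"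
    proof (cases "i = 0 \<or> j = 0")
      case True
      then show ?thesis unfolding s using ij col0 row0 e by (auto simp: U_def d_def)
    next
      case False
      then obtain i' j' where i'j': "i = Suc i'" "j = Suc j'" by (meson not0_implies_Suc)
      have "(\<Sum>k<n. U $$ (i, Suc k) * d (Suc k) * cnj (U $$ (j, Suc k))) = B1 $$ (i', j')"
        unfolding B1U using U1' i'j' ij by (subst index_diag_conj) (auto simp: U_def d_def)
      then show ?thesis unfolding s using i'j' ij by (auto simp: U_def B1_def)
    qed
  qed (use U B in auto)
  note BU = this
  have "A = W * (U * ?D * mat_adjoint U) * mat_adjoint W" by (subst AB) (simp only: BU)
  also have "\<dots> = (W * U) * ?D * mat_adjoint (W * U)"
    using W'(1) U by (intro conj_mat_mult) auto
  finally have "A = (W * U) * ?D * mat_adjoint (W * U)" .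
  then have "diagonalizes (Suc n) (W * U) d A"
    using unitary_mult[OF W Uu] by (simp only: diagonalizes_def simp_thms)
  then show ?case by blast
qed

lemma diagonalizes_carrier: "diagonalizes n U d A \<Longrightarrow> A \<in> carrier_mat n n"
  by (auto simp: diagonalizes_def unitary_mat_def)

lemma diagonalizes_diag:
  assumes "diagonalizes n U d A"
  shows "mat_adjoint U * A * U = mat_diag n (\<lambda>i. complex_of_real (d i))"
proof -
  note U = unitary_matD[of n U]
  show ?thesis using assms U unitary_cancel[of n U _ n]
    by (simp add: diagonalizes_def assoc_mult_mat[of _ n n _ n _ n] right_mult_one_mat[of _ n n])
qed

lemma psd_diagonalizable:
  assumes "psd n A"
  obtains U d where "diagonalizes n U d A" "\<And>i. i < n \<Longrightarrow> 0 \<le> d i"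
proof -
  obtain U d where d: "diagonalizes n U d A"
    using hermitian_diagonalizable[OF psd_carrier[OF assms] psd_hermitian[OF assms]] by blast
  have "psd n (mat_diag n (\<lambda>i. complex_of_real (d i)))"
    using psd_conj[OF assms, of U n] d diagonalizes_diag[OF d]
    by (simp add: diagonalizes_def unitary_mat_def)
  then have "0 \<le> d i" if "i < n" for i
    using psd_diag_nonneg[of n "mat_diag n (\<lambda>i. complex_of_real (d i))" i] that
    by (simp add: mat_diag_def less_eq_complex_def)
  with d show ?thesis by (rule that)
qed

lemma quad_form_diag:
  "quad_form n (mat_diag n (\<lambda>i. complex_of_real (d i))) v = complex_of_real (\<Sum>i<n. d i * (cmod (v i))\<^sup>2)"
proof -
  have "quad_form n (mat_diag n (\<lambda>i. complex_of_real (d i))) v =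
     (\<Sum>i<n. \<Sum>j<n. if j = i then complex_of_real (d i * (cmod (v i))\<^sup>2) else 0)"
    unfolding quad_form_def mat_diag_def
    by (intro sum.cong refl) (simp add: complex_norm_square mult_ac del: of_real_power)
  then show ?thesis by simp
qed

lemma diag_conj_psd:
  assumes "U \<in> carrier_mat m n" "\<And>i. i < n \<Longrightarrow> 0 \<le> d i"
  shows "psd m (U * mat_diag n (\<lambda>i. complex_of_real (d i)) * mat_adjoint U)"
proof -
  have "psd n (mat_diag n (\<lambda>i. complex_of_real (d i)))"
    unfolding psd_iff_quad_form quad_form_diag using assms(2)
    by (auto simp: less_eq_complex_def intro!: sum_nonneg mult_nonneg_nonneg)
  from psd_conj[OF this, of "mat_adjoint U" m] show ?thesis using assms by simp
qed

section \<open>Entropy and the relative entropy of coherence\<close>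

lemma index_mat_diag [simp]:
  "i < n \<Longrightarrow> j < n \<Longrightarrow> mat_diag n f $$ (i, j) = (if i = j then f j else 0)"
  by (simp add: mat_diag_def)

lemma dim_mat_diag [simp]: "dim_row (mat_diag n f) = n" "dim_col (mat_diag n f) = n"
  by (simp_all add: mat_diag_def)

lemma diagonalizesD:
  assumes "diagonalizes n U d A"
  shows "unitary_mat n U" "A = U * mat_diag n (\<lambda>i. complex_of_real (d i)) * mat_adjoint U"
  using assms unfolding diagonalizes_def by (rule conjunct1, rule conjunct2)

lemma diagonalizes_mat_diag:
  "diagonalizes n (1\<^sub>m n) d (mat_diag n (\<lambda>i. complex_of_real (d i)))"
  by (simp add: diagonalizes_def unitary_mat_def left_mult_one_mat[of _ n n] right_mult_one_mat[of _ n n])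

lemma spectral_fun_eqI:
  assumes "diagonalizes n U d A"
  shows "spectral_fun f A = U * mat_diag n (\<lambda>i. complex_of_real (f (d i))) * mat_adjoint U"
    (is "_ = ?B")
proof -
  have "spectral_fun_rel f A ?B"
    unfolding spectral_fun_rel_def using diagonalizesD[OF assms]
    by (intro exI[of _ n] exI[of _ U] exI[of _ d] conjI refl)
  then show ?thesis
    unfolding spectral_fun_def using spectral_fun_rel_unique by (intro the_equality)
qed

lemma mat_log2_eq:
  assumes "diagonalizes n U d A"
  shows "mat_log2 A = U * mat_diag n (\<lambda>i. complex_of_real (log 2 (d i))) * mat_adjoint U"
proof -
  \<comment> \<open>HOL sets \<open>ln 0 = 0\<close>, so the convention on the kernel is built into
    \<open>log\<close> and eigenvalue sums need no case distinction.\<close>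
  have "(if x = 0 then 0 else log 2 x) = log 2 x" for x :: real
    by (simp add: log_def)
  then show ?thesis
    unfolding mat_log2_def spectral_fun_eqI[OF assms] by presburger
qed

lemma mat_trace_diag_mult:
  assumes "A \<in> carrier_mat n n"
  shows "mat_trace (mat_diag n e * A) = (\<Sum>i<n. e i * A $$ (i, i))"
  using assms by (simp add: mat_diag_mult_left mat_trace_def)

lemma mat_trace_mult_diag:
  assumes "A \<in> carrier_mat n n"
  shows "mat_trace (A * mat_diag n e) = (\<Sum>i<n. A $$ (i, i) * e i)"
  using assms by (simp add: mat_diag_mult_right mat_trace_def)

text \<open>Entry \<open>(i, j)\<close> of \<open>mat_adjoint U * V\<close> is the inner product of
  column \<open>i\<close> of \<open>U\<close> with column \<open>j\<close> of \<open>V\<close>. Its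
  squared modulus is the weight through which functions of two noncommuting matrices are
  compared.\<close>

lemma mat_trace_two_diags:
  assumes "U \<in> carrier_mat n n" "V \<in> carrier_mat n n"
  shows "mat_trace ((U * mat_diag n (\<lambda>i. complex_of_real (d i)) * mat_adjoint U) *
      (V * mat_diag n (\<lambda>i. complex_of_real (e i)) * mat_adjoint V)) =
    complex_of_real (\<Sum>i<n. \<Sum>j<n. (cmod ((mat_adjoint U * V) $$ (i, j)))\<^sup>2 * d i * e j)"
    (is "mat_trace ((U * ?D * _) * (V * ?E * _)) = _")
proof -
  define W where "W = mat_adjoint U * V"
  have W: "W \<in> carrier_mat n n" using assms by (simp add: W_def)
  have "(U * ?D * mat_adjoint U) * (V * ?E * mat_adjoint V) = U * (?D * (W * ?E * mat_adjoint V))"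
    using assms by (simp add: W_def assoc_mult_mat[of _ n n _ n _ n])
  then have "mat_trace ((U * ?D * mat_adjoint U) * (V * ?E * mat_adjoint V)) =
      mat_trace (?D * (W * ?E * mat_adjoint V) * U)"
    using assms W by (simp add: mat_trace_comm[of U n n])
  also have "?D * (W * ?E * mat_adjoint V) * U = ?D * (W * ?E * mat_adjoint W)"
    using assms W
    by (simp add: W_def mat_adjoint_mult[of _ n n _ n] assoc_mult_mat[of _ n n _ n _ n])
  also have "mat_trace \<dots> = (\<Sum>i<n. complex_of_real (d i) * (W * ?E * mat_adjoint W) $$ (i, i))"
    using W by (simp add: mat_trace_diag_mult)
  also have "\<dots> = (\<Sum>i<n. \<Sum>j<n. complex_of_real ((cmod (W $$ (i, j)))\<^sup>2 * d i * e j))"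
  proof (intro sum.cong refl)
    fix i assume "i \<in> {..<n}"
    then have "(W * ?E * mat_adjoint W) $$ (i, i) = (\<Sum>k<n. W $$ (i, k) * e k * cnj (W $$ (i, k)))"
      using W by (intro index_diag_conj) auto
    then show "complex_of_real (d i) * (W * ?E * mat_adjoint W) $$ (i, i) =
      (\<Sum>j<n. complex_of_real ((cmod (W $$ (i, j)))\<^sup>2 * d i * e j))"
      by (simp add: sum_distrib_left complex_norm_square mult_ac del: of_real_power)
  qed
  finally show ?thesis by (simp add: W_def)
qed

lemma unitary_row_sum:
  assumes "unitary_mat n W" "i < n"
  shows "(\<Sum>j<n. (cmod (W $$ (i, j)))\<^sup>2) = 1"
proof -
  note W = unitary_matD[OF assms(1)]
  have "1 = (W * mat_adjoint W) $$ (i, i)" using W assms by simp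
  also have "\<dots> = (\<Sum>j<n. W $$ (i, j) * cnj (W $$ (i, j)))"
    using W(1,2) assms by (subst index_mult_mat_sum[of _ n n _ n]) auto
  also have "\<dots> = complex_of_real (\<Sum>j<n. (cmod (W $$ (i, j)))\<^sup>2)"
    by (simp add: complex_norm_square del: of_real_power)
  finally show ?thesis by (metis of_real_eq_1_iff)
qed

text \<open>No normalization is assumed: it will be evaluated on the diagonal blocks of a state,
  whose traces are probabilities.\<close>

definition entropy :: "complex mat \<Rightarrow> real" where
  "entropy A = - Re (mat_trace (A * mat_log2 A))"

lemma diag_conj_mult:
  assumes "unitary_mat n U" "D \<in> carrier_mat n n" "E \<in> carrier_mat n n"
  shows "(U * D * mat_adjoint U) * (U * E * mat_adjoint U) = U * (D * E) * mat_adjoint U"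
  using assms(2,3) unitary_matD(1,2)[OF assms(1)] unitary_cancel[OF assms(1), of _ n]
  by (simp add: assoc_mult_mat[of _ n n _ n _ n])

lemma mat_trace_unitary_conj:
  assumes "unitary_mat n U" "D \<in> carrier_mat n n"
  shows "mat_trace (U * D * mat_adjoint U) = mat_trace D"
  using assms(2) unitary_matD(1,2)[OF assms(1)] unitary_cancel[OF assms(1), of D n]
  by (subst mat_trace_comm[of _ n n]) (simp_all)

lemma entropy_eq:
  assumes "diagonalizes n U d A"
  shows "entropy A = - (\<Sum>i<n. d i * log 2 (d i))"
proof -
  have "mat_trace (A * mat_log2 A) =
      mat_trace (mat_diag n (\<lambda>i. complex_of_real (d i)) * mat_diag n (\<lambda>i. complex_of_real (log 2 (d i))))"
    unfolding mat_log2_eq[OF assms]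
    using diagonalizesD(1)[OF assms]
    by (subst diagonalizesD(2)[OF assms], subst diag_conj_mult)
      (auto simp: mat_trace_unitary_conj simp del: mat_diag_diag)
  then show ?thesis
    unfolding entropy_def by (simp add: mat_trace_mult_diag del: mat_diag_diag)
qed

lemma entropy_mat_diag:
  "entropy (mat_diag n (\<lambda>i. complex_of_real (d i))) = - (\<Sum>i<n. d i * log 2 (d i))"
  using entropy_eq[OF diagonalizes_mat_diag] .

text \<open>In an eigenbasis the form is a sum of nonnegative terms, so each of them vanishes, and
  with it each \<open>d k * w k\<close>, the coordinates of the image vector. All kernel inclusions
  for dephased matrices rest on this.\<close>

lemma psd_quad_form_zero:
  assumes "psd n A" "quad_form n A v = 0" "i < n"
  shows "(\<Sum>j<n. A $$ (i, j) * v j) = 0"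
proof -
  obtain U d where d: "diagonalizes n U d A" "\<And>i. i < n \<Longrightarrow> 0 \<le> d i"
    using psd_diagonalizable[OF assms(1)] by blast
  note U = unitary_matD[OF diagonalizesD(1)[OF d(1)]]
  define w where "w k = (\<Sum>j<n. mat_adjoint U $$ (k, j) * v j)" for k
  have "quad_form n A v = quad_form n (mat_diag n (\<lambda>i. complex_of_real (d i))) w"
    using quad_form_conj[of _ n "mat_adjoint U" n v] U(2)
    unfolding diagonalizesD(2)[OF d(1)] w_def by simp
  then have "(\<Sum>k<n. d k * (cmod (w k))\<^sup>2) = 0"
    unfolding assms(2) quad_form_diag by (metis of_real_eq_0_iff)
  then have "\<forall>k\<in>{..<n}. d k * (cmod (w k))\<^sup>2 = 0"
    by (subst (asm) sum_nonneg_eq_0_iff) (use d(2) in auto)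
  then have z: "d k * w k = 0" if "k < n" for k
    using that by auto
  have "A $$ (i, j) = (\<Sum>k<n. U $$ (i, k) * d k * cnj (U $$ (j, k)))" if "j < n" for j
    by (subst diagonalizesD(2)[OF d(1)]) (rule index_diag_conj[OF U(1) assms(3) that])
  then have "(\<Sum>j<n. A $$ (i, j) * v j) = (\<Sum>j<n. \<Sum>k<n. U $$ (i, k) * d k * cnj (U $$ (j, k)) * v j)"
    by (simp add: sum_distrib_right)
  also have "\<dots> = (\<Sum>k<n. U $$ (i, k) * (d k * w k))"
    using U(1) by (subst sum.swap) (auto simp: w_def sum_distrib_left mult_ac intro!: sum.cong)
  finally show ?thesis using z by simp
qed

lemma mat_kernel_subset_iff:
  fixes A B :: "complex mat"
  assumes "A \<in> carrier_mat n n" "B \<in> carrier_mat n n"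
  shows "mat_kernel A \<subseteq> mat_kernel B \<longleftrightarrow>
    (\<forall>v. (\<forall>i<n. (\<Sum>j<n. A $$ (i, j) * v j) = 0) \<longrightarrow> (\<forall>i<n. (\<Sum>j<n. B $$ (i, j) * v j) = 0))"
    (is "?L = ?R")
proof -
  have k: "vec n v \<in> mat_kernel C \<longleftrightarrow> (\<forall>i<n. (\<Sum>j<n. C $$ (i, j) * v j) = 0)"
    if "C \<in> carrier_mat n n" for C :: "complex mat" and v
    using that by (auto simp: mat_kernel_def vec_eq_iff scalar_prod_def atLeast0LessThan)
  show ?thesis
  proof
    assume ?L
    then show ?R unfolding k[OF assms(1), symmetric] k[OF assms(2), symmetric] by auto
  next
    assume R: ?R
    show ?L
    proof
      fix w assume w: "w \<in> mat_kernel A"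
      have "w = vec n (\<lambda>i. w $ i)" using w assms by (intro eq_vecI) (auto simp: mat_kernel_def)
      then show "w \<in> mat_kernel B"
        using w R[unfolded k[OF assms(1), symmetric] k[OF assms(2), symmetric], rule_format, of "\<lambda>i. w $ i"]
        by simp
    qed
  qed
qed

definition dephase :: "complex mat \<Rightarrow> complex mat" where
  "dephase A = mat_diag (dim_row A) (\<lambda>i. A $$ (i, i))"

lemma psd_diag_real: "psd n A \<Longrightarrow> i < n \<Longrightarrow> complex_of_real (Re (A $$ (i, i))) = A $$ (i, i)"
  using psd_diag_nonneg[of n A i] by (simp add: less_eq_complex_def complex_eq_iff)

lemma dephase_eq:
  assumes "psd n A"
  shows "dephase A = mat_diag n (\<lambda>i. complex_of_real (Re (A $$ (i, i))))"
  using psd_carrier[OF assms] psd_diag_real[OF assms]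
  by (intro eq_matI) (auto simp: dephase_def)

lemma entropy_dephase:
  assumes "psd n A"
  shows "entropy (dephase A) = - (\<Sum>i<n. Re (A $$ (i, i)) * log 2 (Re (A $$ (i, i))))"
  unfolding dephase_eq[OF assms] by (rule entropy_mat_diag)

text \<open>The closed formula for the relative entropy of coherence. Unlike an infimum over
  normalized states, it scales linearly on positive matrices, which is what the unnormalized blocks
  require.\<close>

definition coherence :: "complex mat \<Rightarrow> real" where
  "coherence A = entropy (dephase A) - entropy A"

text \<open>Termwise, \<open>ln x \<le> x - 1\<close> at \<open>x = s i / r i\<close> bounds the
  difference by \<open>(s i - r i) / ln 2\<close>, and these bounds sum to at most 0. For
  \<open>r i = 0\<close> the difference is 0 and the bound is nonnegative.\<close>

lemma gibbs_inequality:
  fixes r s :: "nat \<Rightarrow> real"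
  assumes "\<And>i. i < n \<Longrightarrow> 0 \<le> r i" "\<And>i. i < n \<Longrightarrow> 0 \<le> s i" "(\<Sum>i<n. s i) \<le> (\<Sum>i<n. r i)"
    and supp: "\<And>i. i < n \<Longrightarrow> s i = 0 \<Longrightarrow> r i = 0"
  shows "(\<Sum>i<n. r i * log 2 (s i)) \<le> (\<Sum>i<n. r i * log 2 (r i))"
proof -
  have "r i * log 2 (s i) - r i * log 2 (r i) \<le> (s i - r i) / ln 2" if i: "i < n" for i
  proof (cases "r i = 0")
    case False
    then have pos: "0 < r i" "0 < s i" using assms(1,2)[OF i] supp[OF i] by fastforce+
    then have "r i * ln (s i / r i) \<le> r i * (s i / r i - 1)"
      by (intro mult_left_mono ln_le_minus_one) auto
    also have "r i * (s i / r i - 1) = s i - r i" using pos by (simp add: right_diff_distrib)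
    finally have "r i * (ln (s i) - ln (r i)) / ln 2 \<le> (s i - r i) / ln 2"
      using pos by (intro divide_right_mono) (auto simp: ln_div)
    then show ?thesis by (simp add: log_def diff_divide_distrib right_diff_distrib)
  qed (use assms(2)[OF i] in simp)
  then have "(\<Sum>i<n. r i * log 2 (s i) - r i * log 2 (r i)) \<le> (\<Sum>i<n. (s i - r i) / ln 2)"
    by (intro sum_mono) auto
  also have "\<dots> = ((\<Sum>i<n. s i) - (\<Sum>i<n. r i)) / ln 2"
    by (simp add: sum_divide_distrib[symmetric] sum_subtractf)
  also have "\<dots> \<le> 0" using assms(3) by (simp add: divide_nonpos_pos)
  finally show ?thesis by (simp add: sum_subtractf)
qed

lemma rel_entropy_mat_diag:
  assumes "\<rho> \<in> carrier_mat n n" "mat_kernel (mat_diag n (\<lambda>i. complex_of_real (s i))) \<subseteq> mat_kernel \<rho>"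
  shows "rel_entropy \<rho> (mat_diag n (\<lambda>i. complex_of_real (s i))) =
    ereal (- entropy \<rho> - (\<Sum>i<n. Re (\<rho> $$ (i, i)) * log 2 (s i)))"
proof -
  have "mat_log2 (mat_diag n (\<lambda>i. complex_of_real (s i))) = mat_diag n (\<lambda>i. complex_of_real (log 2 (s i)))"
    unfolding mat_log2_eq[OF diagonalizes_mat_diag]
    by (simp add: left_mult_one_mat[of _ n n] right_mult_one_mat[of _ n n])
  then show ?thesis using assms by (simp add: rel_entropy_def entropy_def mat_trace_mult_diag)
qed

text \<open>Against a diagonal \<open>\<sigma>\<close> the relative entropy sees only the entropy
  and the diagonal of \<open>\<rho>\<close>, so the minimization is classical and Gibbs' inequality
  singles out the diagonal of \<open>\<rho>\<close> as the best \<open>\<sigma>\<close>.\<close>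

theorem rel_entropy_coherence_eq:
  assumes "\<rho> \<in> states n"
  shows "rel_entropy_coherence \<rho> = ereal (coherence \<rho>)"
proof -
  have psd: "psd n \<rho>" and tr: "mat_trace \<rho> = 1" using assms by (auto simp: states_def)
  note c = psd_carrier[OF psd]
  define r where "r i = Re (\<rho> $$ (i, i))" for i
  have r: "0 \<le> r i" if "i < n" for i
    using psd_diag_nonneg[OF psd that] by (simp add: r_def less_eq_complex_def)
  have r1: "(\<Sum>i<n. r i) = 1" using tr c by (simp add: mat_trace_def r_def flip: Re_sum)
  have dr: "dim_row \<rho> = n" using c by simp
  have coh: "coherence \<rho> = - entropy \<rho> - (\<Sum>i<n. r i * log 2 (r i))"
    by (simp add: coherence_def entropy_dephase[OF psd] r_def)
  have deph: "dephase \<rho> = mat_diag n (\<lambda>i. complex_of_real (r i))"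
    using dephase_eq[OF psd] by (simp add: r_def)
  show ?thesis
    unfolding rel_entropy_coherence_def dr
  proof (rule antisym)
    have "psd n (dephase \<rho>)"
      unfolding deph psd_iff_quad_form quad_form_diag using r
      by (auto simp: less_eq_complex_def intro!: sum_nonneg mult_nonneg_nonneg)
    moreover have "mat_trace (dephase \<rho>) = 1"
      using tr c by (simp add: dephase_def mat_trace_def)
    ultimately have inc: "dephase \<rho> \<in> incoherent_states n"
      by (auto simp: incoherent_states_def states_def dephase_def diagonal_mat_def mat_diag_def)
    have "mat_kernel (dephase \<rho>) \<subseteq> mat_kernel \<rho>"
    proof (subst mat_kernel_subset_iff[of _ n])
      show "\<forall>v. (\<forall>i<n. (\<Sum>j<n. dephase \<rho> $$ (i, j) * v j) = 0) \<longrightarrow> (\<forall>i<n. (\<Sum>j<n. \<rho> $$ (i, j) * v j) = 0)"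
      proof (intro allI impI)
        fix v i assume *: "\<forall>i<n. (\<Sum>j<n. dephase \<rho> $$ (i, j) * v j) = 0" and i: "i < n"
        \<comment> \<open>Where \<open>v j\<close> is nonzero, the diagonal entry of
          \<open>\<rho>\<close> at \<open>j\<close> must be 0; then the basis vector
          \<open>j\<close> is a null vector of the form and the whole column \<open>j\<close> of
          \<open>\<rho>\<close> vanishes.\<close>
        have "\<rho> $$ (i, j) * v j = 0" if j: "j < n" for j
        proof (cases "v j = 0")
          case False
          have "(\<Sum>k<n. dephase \<rho> $$ (j, k) * v k) = (\<Sum>k<n. if k = j then \<rho> $$ (j, j) * v j else 0)"
            using j c by (intro sum.cong) (auto simp: dephase_def)
          then have "quad_form n \<rho> (\<lambda>k. if k = j then 1 else 0) = 0"
            using * j False by (simp add: quad_form_unit)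
          from psd_quad_form_zero[OF psd this i] j
          show ?thesis by (simp add: if_distrib[of "\<lambda>x. _ * x"] cong: if_cong)
        qed simp
        then show "(\<Sum>j<n. \<rho> $$ (i, j) * v j) = 0" by (intro sum.neutral) auto
      qed
    qed (use c in \<open>auto simp: dephase_def\<close>)
    then have "rel_entropy \<rho> (dephase \<rho>) = ereal (coherence \<rho>)"
      unfolding deph by (subst rel_entropy_mat_diag[OF c]) (auto simp: coh r_def)
    then show "(INF \<sigma>\<in>incoherent_states n. rel_entropy \<rho> \<sigma>) \<le> ereal (coherence \<rho>)"
      using INF_lower[OF inc, of "rel_entropy \<rho>"] by simp
  next
    show "ereal (coherence \<rho>) \<le> (INF \<sigma>\<in>incoherent_states n. rel_entropy \<rho> \<sigma>)"
    proof (rule INF_greatest)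
      fix \<sigma> assume "\<sigma> \<in> incoherent_states n"
      then have s: "psd n \<sigma>" "mat_trace \<sigma> = 1" "diagonal_mat \<sigma>"
        by (auto simp: incoherent_states_def states_def)
      note sc = psd_carrier[OF s(1)]
      define s where "s i = Re (\<sigma> $$ (i, i))" for i
      have \<sigma>: "\<sigma> = mat_diag n (\<lambda>i. complex_of_real (s i))"
        using s(3) sc psd_diag_real[OF s(1)]
        by (intro eq_matI) (auto simp: s_def diagonal_mat_def)
      show "ereal (coherence \<rho>) \<le> rel_entropy \<rho> \<sigma>"
      proof (cases "mat_kernel \<sigma> \<subseteq> mat_kernel \<rho>")
        case True
        have "(\<Sum>i<n. r i * log 2 (s i)) \<le> (\<Sum>i<n. r i * log 2 (r i))"
        proof (rule gibbs_inequality)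
          show "0 \<le> s i" if "i < n" for i
            using psd_diag_nonneg[OF s(1) that] by (simp add: s_def less_eq_complex_def)
          show "(\<Sum>i<n. s i) \<le> (\<Sum>i<n. r i)"
            using s(2) sc r1 by (simp add: mat_trace_def s_def flip: Re_sum)
          fix i assume i: "i < n" "s i = 0"
          \<comment> \<open>The basis vector \<open>i\<close> lies in the kernel of
            \<open>\<sigma>\<close>, hence in that of \<open>\<rho>\<close>, so column
            \<open>i\<close> of \<open>\<rho>\<close> is 0 and with it the diagonal entry
            \<open>r i\<close>.\<close>
          have "(\<Sum>j<n. \<sigma> $$ (k, j) * (if j = i then 1 else 0)) = 0" if "k < n" for k
            using that i by (simp add: \<sigma> if_distrib[of "\<lambda>x. _ * x"] cong: if_cong)
          from True[unfolded mat_kernel_subset_iff[OF sc c], rule_format, OF this i(1)]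
          have "(\<Sum>j<n. \<rho> $$ (i, j) * (if j = i then 1 else 0)) = 0" .
          then show "r i = 0"
            using i by (simp add: r_def if_distrib[of "\<lambda>x. _ * x"] cong: if_cong)
        qed (use r in auto)
        then show ?thesis
          using rel_entropy_mat_diag[OF c, of s] True by (simp add: \<sigma> coh r_def)
      qed (simp add: rel_entropy_def)
    qed
  qed
qed

section \<open>Schwarz inequality for channels\<close>

lemma sum_lessThan_mult: "(\<Sum>i<n * k. f i) = (\<Sum>a<n. \<Sum>b<k. f (a * k + b))"
  for f :: "nat \<Rightarrow> 'a::comm_monoid_add"
proof -
  have "(\<Sum>b<k. f (a * k + b)) = sum f {a * k..<a * k + k}" for a
    by (rule sum.reindex_bij_witness[of _ "\<lambda>i. i - a * k" "\<lambda>b. a * k + b"]) auto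
  then show ?thesis by (simp add: sum.nat_group)
qed

text \<open>Testing on matrix units forces the entry of \<open>X\<close> at \<open>(i, j)\<close> to
  be \<open>L (E j i)\<close>. This is how a channel gets its Heisenberg dual without Kraus
  operators.\<close>

lemma linear_functional_eq_trace:
  assumes add: "\<And>M N. M \<in> carrier_mat m m \<Longrightarrow> N \<in> carrier_mat m m \<Longrightarrow> L (M + N) = L M + L N"
    and smult: "\<And>c M. M \<in> carrier_mat m m \<Longrightarrow> L (c \<cdot>\<^sub>m M) = c * L M"
  obtains X where "X \<in> carrier_mat m m" "\<And>M. M \<in> carrier_mat m m \<Longrightarrow> L M = mat_trace (M * X)"
proof -
  define E where "E i j = mat m m (\<lambda>(a, b). if a = i \<and> b = j then 1 else 0 :: complex)" for i j
  define X where "X = mat m m (\<lambda>(i, j). L (E j i))"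
  have X: "X \<in> carrier_mat m m" by (simp add: X_def)
  have "L M = mat_trace (M * X)" if M: "M \<in> carrier_mat m m" for M
  proof -
    \<comment> \<open>\<open>R S\<close> keeps only the entries of \<open>M\<close> at positions in
      \<open>S\<close>, so that additivity of \<open>L\<close> can be used one entry at a time, by
      induction on \<open>S\<close>.\<close>
    define R where "R S = mat m m (\<lambda>(a, b). if (a, b) \<in> S then M $$ (a, b) else 0)" for S
    have R: "L (R S) = (\<Sum>(i, j)\<in>S. M $$ (i, j) * L (E i j))" if "S \<subseteq> {..<m} \<times> {..<m}" for S
      using finite_subset[OF that finite_cartesian_product[OF finite_lessThan finite_lessThan]] that
    proof (induction S rule: finite_induct)
      case empty
      have "R {} = 0 \<cdot>\<^sub>m R {}" by (intro eq_matI) (auto simp: R_def)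
      then have "L (R {}) = 0 * L (R {})" using smult[of "R {}" 0] by (simp add: R_def)
      then show ?case by simp
    next
      case (insert x S)
      obtain i j where x: "x = (i, j)" by fastforce
      have "R (insert x S) = M $$ (i, j) \<cdot>\<^sub>m E i j + R S"
        using insert.hyps insert.prems by (intro eq_matI) (auto simp: R_def E_def x)
      then have "L (R (insert x S)) = M $$ (i, j) * L (E i j) + L (R S)"
        by (simp add: add smult E_def R_def)
      then show ?case using insert by (simp add: x)
    qed
    have "R ({..<m} \<times> {..<m}) = M" using M by (intro eq_matI) (auto simp: R_def)
    then have "L M = (\<Sum>(i, j)\<in>{..<m} \<times> {..<m}. M $$ (i, j) * L (E i j))" using R by force
    also have "\<dots> = mat_trace (M * X)"
      unfolding mat_trace_mult[OF M X] sum.cartesian_product by (intro sum.cong) (auto simp: X_def)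
    finally show ?thesis .
  qed
  with X show ?thesis by (rule that)
qed

text \<open>Conjugating \<open>H\<close> by the column of blocks \<open>-Z\<close> and the identity
  gives a positive matrix whose trace is the expression shown. The ancilla index is the fast one, so
  the four blocks of \<open>H\<close> are interleaved and not contiguous.\<close>

lemma psd_two_block:
  assumes H: "psd (n * 2) H" and Z: "Z \<in> carrier_mat n n"
    and c: "H00 \<in> carrier_mat n n" "H01 \<in> carrier_mat n n" "H10 \<in> carrier_mat n n" "H11 \<in> carrier_mat n n"
    and blocks: "\<And>a b. a < n \<Longrightarrow> b < n \<Longrightarrow> H $$ (a * 2, b * 2) = H00 $$ (a, b)"
      "\<And>a b. a < n \<Longrightarrow> b < n \<Longrightarrow> H $$ (a * 2, b * 2 + 1) = H01 $$ (a, b)"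
      "\<And>a b. a < n \<Longrightarrow> b < n \<Longrightarrow> H $$ (a * 2 + 1, b * 2) = H10 $$ (a, b)"
      "\<And>a b. a < n \<Longrightarrow> b < n \<Longrightarrow> H $$ (a * 2 + 1, b * 2 + 1) = H11 $$ (a, b)"
  shows "0 \<le> mat_trace (mat_adjoint Z * H00 * Z) - mat_trace (mat_adjoint Z * H01)
      - mat_trace (H10 * Z) + mat_trace H11"
    and "mat_adjoint H10 = H01"
proof -
  \<comment> \<open>Column \<open>c\<close> of the stacked matrix: even positions carry
    \<open>-Z\<close>, odd positions the identity.\<close>
  define w where "w c i = (if i mod 2 = 0 then - Z $$ (i div 2, c) else if i div 2 = c then 1 else 0)" for c i
  have w: "w c (a * 2) = - Z $$ (a, c)" "w c (Suc (a * 2)) = (if a = c then 1 else 0)" for a c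
  proof -
    have "Suc (a * 2) mod 2 = 1" "Suc (a * 2) div 2 = a" by presburger+
    then show "w c (a * 2) = - Z $$ (a, c)" "w c (Suc (a * 2)) = (if a = c then 1 else 0)"
      by (simp_all add: w_def)
  qed
  have double: "(\<Sum>i<n * 2. f i) = (\<Sum>a<n. f (a * 2) + f (Suc (a * 2)))" for f :: "nat \<Rightarrow> complex"
    unfolding sum_lessThan_mult by (intro sum.cong refl) (simp add: numeral_2_eq_2)
  have q: "quad_form (n * 2) H (w c) = (\<Sum>a<n. \<Sum>b<n. cnj (Z $$ (a, c)) * H00 $$ (a, b) * Z $$ (b, c))
      - (\<Sum>a<n. cnj (Z $$ (a, c)) * H01 $$ (a, c)) - (\<Sum>b<n. H10 $$ (c, b) * Z $$ (b, c)) + H11 $$ (c, c)"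
    if c: "c < n" for c
  proof -
    define t1 where "t1 a b = cnj (Z $$ (a, c)) * H00 $$ (a, b) * Z $$ (b, c)" for a b
    define t2 where "t2 a b = (if b = c then cnj (Z $$ (a, c)) * H01 $$ (a, c) else 0)" for a b
    define t3 where "t3 a b = (if a = c then H10 $$ (c, b) * Z $$ (b, c) else 0)" for a b
    define t4 where "t4 a b = (if a = c then if b = c then H11 $$ (c, c) else 0 else 0)" for a b
    have "quad_form (n * 2) H (w c) = (\<Sum>a<n. \<Sum>b<n. t1 a b - t2 a b - t3 a b + t4 a b)"
      unfolding quad_form_def double sum.distrib[symmetric]
    proof (intro sum.cong refl)
      fix a b assume "a \<in> {..<n}" "b \<in> {..<n}"
      then have "H $$ (a * 2, b * 2) = H00 $$ (a, b)" "H $$ (a * 2, Suc (b * 2)) = H01 $$ (a, b)"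
        "H $$ (Suc (a * 2), b * 2) = H10 $$ (a, b)" "H $$ (Suc (a * 2), Suc (b * 2)) = H11 $$ (a, b)"
        using blocks[of a b] by simp_all
      then show "cnj (w c (a * 2)) * H $$ (a * 2, b * 2) * w c (b * 2) +
          cnj (w c (a * 2)) * H $$ (a * 2, Suc (b * 2)) * w c (Suc (b * 2)) +
          (cnj (w c (Suc (a * 2))) * H $$ (Suc (a * 2), b * 2) * w c (b * 2) +
           cnj (w c (Suc (a * 2))) * H $$ (Suc (a * 2), Suc (b * 2)) * w c (Suc (b * 2))) =
          t1 a b - t2 a b - t3 a b + t4 a b"
        unfolding t1_def t2_def t3_def t4_def w by (cases "a = c"; cases "b = c") simp_all
    qed
    also have "\<dots> = (\<Sum>a<n. \<Sum>b<n. t1 a b) - (\<Sum>a<n. \<Sum>b<n. t2 a b) - (\<Sum>a<n. \<Sum>b<n. t3 a b) + (\<Sum>a<n. \<Sum>b<n. t4 a b)"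
      by (simp add: sum.distrib sum_subtractf)
    also have "(\<Sum>a<n. \<Sum>b<n. t2 a b) = (\<Sum>a<n. cnj (Z $$ (a, c)) * H01 $$ (a, c))"
      using c by (simp add: t2_def)
    also have "(\<Sum>a<n. \<Sum>b<n. t3 a b) = (\<Sum>b<n. H10 $$ (c, b) * Z $$ (b, c))"
      using c by (subst sum.swap) (simp add: t3_def)
    also have "(\<Sum>a<n. \<Sum>b<n. t4 a b) = (\<Sum>a<n. if a = c then H11 $$ (c, c) else 0)"
      using c by (intro sum.cong refl) (simp add: t4_def)
    finally show ?thesis using c by (simp add: t1_def)
  qed
  have t00: "mat_trace (mat_adjoint Z * H00 * Z) =
      (\<Sum>c<n. \<Sum>a<n. \<Sum>b<n. cnj (Z $$ (a, c)) * H00 $$ (a, b) * Z $$ (b, c))"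
  proof -
    have "mat_trace (mat_adjoint Z * H00 * Z) = (\<Sum>c<n. quad_form n (mat_adjoint Z * H00 * Z) (\<lambda>k. if k = c then 1 else 0))"
      using c Z by (simp add: mat_trace_def quad_form_unit)
    also have "\<dots> = (\<Sum>c<n. quad_form n H00 (\<lambda>i. Z $$ (i, c)))"
      unfolding quad_form_conj[OF c(1) Z] by (intro sum.cong refl quad_form_cong)
        (simp add: if_distrib[of "\<lambda>x. _ * x"] cong: if_cong)
    finally show ?thesis by (simp add: quad_form_def)
  qed
  have "mat_trace (mat_adjoint Z * H01) = (\<Sum>c<n. \<Sum>a<n. cnj (Z $$ (a, c)) * H01 $$ (a, c))"
    using c Z by (subst mat_trace_mult[of _ n n]) auto
  moreover have "mat_trace (H10 * Z) = (\<Sum>c<n. \<Sum>b<n. H10 $$ (c, b) * Z $$ (b, c))"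
    using mat_trace_mult[OF c(3) Z] .
  moreover have "mat_trace H11 = (\<Sum>c<n. H11 $$ (c, c))"
    using c by (simp add: mat_trace_def)
  moreover have "0 \<le> (\<Sum>c<n. quad_form (n * 2) H (w c))"
    using H by (intro sum_nonneg) (auto simp: psd_iff_quad_form)
  ultimately show "0 \<le> mat_trace (mat_adjoint Z * H00 * Z) - mat_trace (mat_adjoint Z * H01)
      - mat_trace (H10 * Z) + mat_trace H11"
    by (simp add: q t00 sum.distrib sum_subtractf)
  show "mat_adjoint H10 = H01"
  proof (rule eq_matI)
    fix a b assume "a < dim_row H01" "b < dim_col H01"
    then have ab: "a < n" "b < n" using c by auto
    have "mat_adjoint H10 $$ (a, b) = cnj (H $$ (b * 2 + 1, a * 2))" using ab c blocks by simp
    also have "\<dots> = mat_adjoint H $$ (a * 2, b * 2 + 1)" using ab psd_carrier[OF H] by simp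
    also have "\<dots> = H01 $$ (a, b)" using ab psd_hermitian[OF H] blocks by simp
    finally show "mat_adjoint H10 $$ (a, b) = H01 $$ (a, b)" .
  qed (use c in auto)
qed

lemma quantum_channelD:
  assumes "quantum_channel m n \<Psi>"
  shows "X \<in> carrier_mat m m \<Longrightarrow> \<Psi> X \<in> carrier_mat n n"
    and "X \<in> carrier_mat m m \<Longrightarrow> Y \<in> carrier_mat m m \<Longrightarrow> \<Psi> (X + Y) = \<Psi> X + \<Psi> Y"
    and "X \<in> carrier_mat m m \<Longrightarrow> \<Psi> (c \<cdot>\<^sub>m X) = c \<cdot>\<^sub>m \<Psi> X"
    and "X \<in> carrier_mat m m \<Longrightarrow> mat_trace (\<Psi> X) = mat_trace X"
    and "1 \<le> k \<Longrightarrow> psd (m * k) Y \<Longrightarrow> psd (n * k) (tensor_id m n k \<Psi> Y)"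
  using assms
  by (auto simp: quantum_channel_def linear_superop_def trace_preserving_def completely_positive_def)

text \<open>
  Applying \<open>\<Psi> \<otimes> 1\<^sub>2\<close> to the positive matrix with blocks
  \<open>\<rho>, \<rho> K\<^sup>\<dagger>, K \<rho>, K \<rho> K\<^sup>\<dagger>\<close> and testing the result on the columns of \<open>(-Z, 1)\<close>.
\<close>

lemma channel_block_ineq:
  assumes \<Psi>: "quantum_channel m n \<Psi>" and \<rho>: "psd m \<rho>"
    and K: "K \<in> carrier_mat m m" and Z: "Z \<in> carrier_mat n n"
  shows "2 * Re (mat_trace (\<Psi> (K * \<rho>) * Z)) \<le>
      Re (mat_trace (\<Psi> \<rho> * (Z * mat_adjoint Z))) + Re (mat_trace (K * \<rho> * mat_adjoint K))"
    and "mat_adjoint (\<Psi> (K * \<rho>)) = \<Psi> (\<rho> * mat_adjoint K)"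
proof -
  note rc = psd_carrier[OF \<rho>]
  note \<Psi>c = quantum_channelD(1)[OF \<Psi>]
  \<comment> \<open>\<open>B\<close> is the identity stacked on \<open>K\<close> with interleaved
    rows; hence \<open>G\<close> has the announced blocks and is positive as a congruence of
    \<open>\<rho>\<close>.\<close>
  define B where "B = mat (m * 2) m (\<lambda>(i, c). if i mod 2 = 0 then (if i div 2 = c then 1 else 0) else K $$ (i div 2, c))"
  define G where "G = B * \<rho> * mat_adjoint B"
  have B: "B \<in> carrier_mat (m * 2) m" by (simp add: B_def)
  have "psd (m * 2) G" using psd_conj[OF \<rho>, of "mat_adjoint B"] B by (simp add: G_def)
  then have H: "psd (n * 2) (tensor_id m n 2 \<Psi> G)"
    using quantum_channelD(5)[OF \<Psi>] by simp
  define Bs where "Bs s = mat m m (\<lambda>(a, c). B $$ (a * 2 + s, c))" for s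
  have Bs0: "Bs 0 = 1\<^sub>m m" by (rule eq_matI) (auto simp: Bs_def B_def)
  have Bs1: "Bs 1 = K" using K by (intro eq_matI) (auto simp: Bs_def B_def)
  have block: "partial_block m 2 G s s' = Bs s * \<rho> * mat_adjoint (Bs s')" if "s < 2" "s' < 2" for s s'
  proof (rule eq_matI)
    have Bsc: "Bs s \<in> carrier_mat m m" "Bs s' \<in> carrier_mat m m" by (simp_all add: Bs_def)
    fix a c assume "a < dim_row (Bs s * \<rho> * mat_adjoint (Bs s'))" "c < dim_col (Bs s * \<rho> * mat_adjoint (Bs s'))"
    then have ac: "a < m" "c < m" using Bsc by auto
    then have i: "a * 2 + s < m * 2" "c * 2 + s' < m * 2" using that by auto
    have "G $$ (a * 2 + s, c * 2 + s') =
        (\<Sum>e<m. (\<Sum>d<m. B $$ (a * 2 + s, d) * \<rho> $$ (d, e)) * cnj (B $$ (c * 2 + s', e)))"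
      unfolding G_def using B rc i
      by (subst index_mult_mat_sum[of _ "m * 2" m _ "m * 2"], simp, simp, simp, simp, intro sum.cong refl,
        subst index_mult_mat_sum[of _ "m * 2" m _ m]) auto
    also have "\<dots> = (\<Sum>e<m. (\<Sum>d<m. Bs s $$ (a, d) * \<rho> $$ (d, e)) * cnj (Bs s' $$ (c, e)))"
      using ac by (simp add: Bs_def)
    also have "\<dots> = (Bs s * \<rho> * mat_adjoint (Bs s')) $$ (a, c)"
      using Bsc rc ac
      by (subst index_mult_mat_sum[of _ m m _ m], simp, simp, simp, simp, intro sum.cong refl,
        subst index_mult_mat_sum[of _ m m _ m]) auto
    finally show "partial_block m 2 G s s' $$ (a, c) = (Bs s * \<rho> * mat_adjoint (Bs s')) $$ (a, c)"
      using ac by (simp add: partial_block_def)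
  qed (auto simp: partial_block_def Bs_def)
  have bl: "partial_block m 2 G 0 0 = \<rho>" "partial_block m 2 G 0 1 = \<rho> * mat_adjoint K"
    "partial_block m 2 G 1 0 = K * \<rho>" "partial_block m 2 G 1 1 = K * \<rho> * mat_adjoint K"
    using rc K
    by (simp_all add: block Bs0 Bs1 left_mult_one_mat[of _ m m] right_mult_one_mat[of _ m m] flip: One_nat_def)
  have idx: "tensor_id m n 2 \<Psi> G $$ (a * 2 + s, b * 2 + s') = \<Psi> (partial_block m 2 G s s') $$ (a, b)"
    if "a < n" "b < n" "s < 2" "s' < 2" for a b s s'
  proof -
    have "a * 2 + s < n * 2" "b * 2 + s' < n * 2" using that by auto
    then show ?thesis using that by (simp add: tensor_id_def)
  qed
  have blk: "0 \<le> mat_trace (mat_adjoint Z * \<Psi> \<rho> * Z) - mat_trace (mat_adjoint Z * \<Psi> (\<rho> * mat_adjoint K))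
      - mat_trace (\<Psi> (K * \<rho>) * Z) + mat_trace (\<Psi> (K * \<rho> * mat_adjoint K))"
    "mat_adjoint (\<Psi> (K * \<rho>)) = \<Psi> (\<rho> * mat_adjoint K)"
    by (rule psd_two_block[OF H Z];
        use idx[where s = 0 and s' = 0] idx[where s = 0 and s' = 1] idx[where s = 1 and s' = 0]
          idx[where s = 1 and s' = 1] rc K bl in \<open>simp add: \<Psi>c\<close>)+
  show "mat_adjoint (\<Psi> (K * \<rho>)) = \<Psi> (\<rho> * mat_adjoint K)" by (rule blk(2))
  \<comment> \<open>The two cross terms are complex conjugates of each other, whence the factor
    \<open>2 * Re\<close>.\<close>
  have "mat_adjoint Z * \<Psi> (\<rho> * mat_adjoint K) = mat_adjoint (\<Psi> (K * \<rho>) * Z)"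
    using Z K rc \<Psi>c unfolding blk(2)[symmetric] by (subst mat_adjoint_mult[of _ n n _ n]) auto
  then have "mat_trace (mat_adjoint Z * \<Psi> (\<rho> * mat_adjoint K)) = cnj (mat_trace (\<Psi> (K * \<rho>) * Z))"
    using Z K rc \<Psi>c by (subst mat_trace_adjoint[of _ n, symmetric]) auto
  moreover have "mat_trace (mat_adjoint Z * \<Psi> \<rho> * Z) = mat_trace (\<Psi> \<rho> * (Z * mat_adjoint Z))"
    using Z rc \<Psi>c
    by (simp add: assoc_mult_mat[of _ n n _ n _ n] mat_trace_comm[of "mat_adjoint Z" n n])
  moreover have "mat_trace (\<Psi> (K * \<rho> * mat_adjoint K)) = mat_trace (K * \<rho> * mat_adjoint K)"
    using K rc by (intro quantum_channelD(4)[OF \<Psi>]) auto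
  ultimately show "2 * Re (mat_trace (\<Psi> (K * \<rho>) * Z)) \<le>
      Re (mat_trace (\<Psi> \<rho> * (Z * mat_adjoint Z))) + Re (mat_trace (K * \<rho> * mat_adjoint K))"
    using blk(1) by (simp add: less_eq_complex_def)
qed

text \<open>\<open>X\<close> is the image of \<open>Y\<close> under the Heisenberg dual of \<open>\<Psi>\<close>, for which the Kadison--Schwarz inequality holds.\<close>

lemma channel_dual_schwarz:
  assumes \<Psi>: "quantum_channel m n \<Psi>" and Y: "Y \<in> carrier_mat n n"
  obtains X where "X \<in> carrier_mat m m"
    "\<And>M. M \<in> carrier_mat m m \<Longrightarrow> mat_trace (\<Psi> M * Y) = mat_trace (M * X)"
    "\<And>\<rho>. psd m \<rho> \<Longrightarrow> Re (mat_trace (\<rho> * (X * mat_adjoint X))) \<le> Re (mat_trace (\<Psi> \<rho> * (Y * mat_adjoint Y)))"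
    "\<And>\<rho>. psd m \<rho> \<Longrightarrow> Re (mat_trace (\<rho> * (mat_adjoint X * X))) \<le> Re (mat_trace (\<Psi> \<rho> * (mat_adjoint Y * Y)))"
proof -
  note \<Psi>D = quantum_channelD[OF \<Psi>]
  have add: "mat_trace (\<Psi> (M + N) * Y) = mat_trace (\<Psi> M * Y) + mat_trace (\<Psi> N * Y)"
    if "M \<in> carrier_mat m m" "N \<in> carrier_mat m m" for M N
    using that Y \<Psi>D(1) by (simp add: \<Psi>D(2) add_mult_distrib_mat[of _ n n] mat_trace_add[of _ n])
  have smult: "mat_trace (\<Psi> (c \<cdot>\<^sub>m M) * Y) = c * mat_trace (\<Psi> M * Y)"
    if "M \<in> carrier_mat m m" for c M
    using that Y \<Psi>D(1) by (simp add: \<Psi>D(3) mult_smult_assoc_mat[of _ n n] mat_trace_smult[of _ n])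
  obtain X where X: "X \<in> carrier_mat m m"
    and dual: "\<And>M. M \<in> carrier_mat m m \<Longrightarrow> mat_trace (\<Psi> M * Y) = mat_trace (M * X)"
    using linear_functional_eq_trace[of m "\<lambda>M. mat_trace (\<Psi> M * Y)", OF add smult] by blast
  show ?thesis
  proof (rule that[OF X dual])
    fix \<rho> assume \<rho>: "psd m \<rho>"
    note rc = psd_carrier[OF \<rho>]
    \<comment> \<open>With \<open>K = mat_adjoint X\<close> duality makes the cross term equal to
      the last term of the block inequality, so \<open>2 * a \<le> b + a\<close> and thus
      \<open>a \<le> b\<close>.\<close>
    have "mat_trace (\<Psi> (mat_adjoint X * \<rho>) * Y) = mat_trace (mat_adjoint X * \<rho> * X)"
      using X rc by (intro dual) auto
    moreover have "mat_trace (mat_adjoint X * \<rho> * X) = mat_trace (\<rho> * (X * mat_adjoint X))"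
      using X rc by (simp add: assoc_mult_mat[of _ m m _ m _ m] mat_trace_comm[of "mat_adjoint X" m m])
    ultimately show "Re (mat_trace (\<rho> * (X * mat_adjoint X))) \<le> Re (mat_trace (\<Psi> \<rho> * (Y * mat_adjoint Y)))"
      using channel_block_ineq(1)[OF \<Psi> \<rho>, of "mat_adjoint X" Y] X Y by simp
    \<comment> \<open>Now \<open>K = X\<close> and \<open>Z = mat_adjoint Y\<close>. Duality is
      stated for \<open>Y\<close>, not for its adjoint, so the cross term is first conjugated, using
      that \<open>\<Psi>\<close> respects adjoints here.\<close>
    have "\<Psi> (X * \<rho>) * mat_adjoint Y = mat_adjoint (Y * \<Psi> (\<rho> * mat_adjoint X))"
      using X Y rc \<Psi>D(1) unfolding channel_block_ineq(2)[OF \<Psi> \<rho> X Y, symmetric]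
      by (subst mat_adjoint_mult[of _ n n _ n]) auto
    then have "Re (mat_trace (\<Psi> (X * \<rho>) * mat_adjoint Y)) = Re (mat_trace (Y * \<Psi> (\<rho> * mat_adjoint X)))"
      using X Y rc \<Psi>D(1) by (simp add: mat_trace_adjoint[of _ n])
    also have "mat_trace (Y * \<Psi> (\<rho> * mat_adjoint X)) = mat_trace (\<rho> * mat_adjoint X * X)"
      using X Y rc \<Psi>D(1) by (subst mat_trace_comm[of _ n n]) (auto intro!: dual)
    also have "\<rho> * mat_adjoint X * X = \<rho> * (mat_adjoint X * X)"
      using X rc by (simp add: assoc_mult_mat[of _ m m _ m _ m])
    finally have "Re (mat_trace (\<Psi> (X * \<rho>) * mat_adjoint Y)) = Re (mat_trace (\<rho> * (mat_adjoint X * X)))" .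
    moreover have "mat_trace (X * \<rho> * mat_adjoint X) = mat_trace (\<rho> * (mat_adjoint X * X))"
      using X rc by (simp add: assoc_mult_mat[of _ m m _ m _ m] mat_trace_comm[of X m m])
    ultimately show "Re (mat_trace (\<rho> * (mat_adjoint X * X))) \<le> Re (mat_trace (\<Psi> \<rho> * (mat_adjoint Y * Y)))"
      using channel_block_ineq(1)[OF \<Psi> \<rho> X, of "mat_adjoint Y"] Y by simp
  qed
qed

section \<open>Monotonicity of the relative entropy\<close>

text \<open>\<open>x\<close> is the matrix of \<open>X\<close> between two bases, rows for the
  eigenvectors of \<open>\<sigma>\<close> and columns for those of \<open>\<rho>\<close>. With this
  mixed choice both quadratic terms become diagonal at once and the overlaps survive only in the
  linear term.\<close>

lemma eigenbasis_traces:
  assumes U: "diagonalizes n U p \<rho>" and V: "diagonalizes n V q \<sigma>"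
    and x: "x \<in> carrier_mat n n" and X: "X = V * x * mat_adjoint U"
  shows "mat_trace (\<rho> * X) = (\<Sum>i<n. \<Sum>j<n. p i * (mat_adjoint U * V) $$ (i, j) * x $$ (j, i))"
    and "mat_trace (\<rho> * (mat_adjoint X * X)) = complex_of_real (\<Sum>i<n. \<Sum>j<n. p i * (cmod (x $$ (j, i)))\<^sup>2)"
    and "mat_trace (\<sigma> * (X * mat_adjoint X)) = complex_of_real (\<Sum>i<n. \<Sum>j<n. q j * (cmod (x $$ (j, i)))\<^sup>2)"
proof -
  note Ud = diagonalizesD[OF U] and Vd = diagonalizesD[OF V]
  note Uc = unitary_matD[OF Ud(1)] and Vc = unitary_matD[OF Vd(1)]
  let ?P = "mat_diag n (\<lambda>i. complex_of_real (p i))" and ?Q = "mat_diag n (\<lambda>i. complex_of_real (q i))"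
  note simps = assoc_mult_mat[of _ n n _ n _ n] mat_adjoint_mult[of _ n n _ n]
    unitary_cancel[OF Ud(1), of _ n] unitary_cancel[OF Vd(1), of _ n]
  define W where "W = mat_adjoint U * V"
  have W: "W \<in> carrier_mat n n" using Uc Vc by (simp add: W_def)
  have "\<rho> * X = U * (?P * (W * x)) * mat_adjoint U"
    unfolding Ud(2) X W_def using Uc(1,2) Vc(1,2) x by (simp add: simps)
  then have "mat_trace (\<rho> * X) = (\<Sum>i<n. p i * (W * x) $$ (i, i))"
    using W x Ud(1) by (simp add: mat_trace_unitary_conj mat_trace_diag_mult)
  also have "\<dots> = (\<Sum>i<n. \<Sum>j<n. p i * W $$ (i, j) * x $$ (j, i))"
    using W x by (intro sum.cong refl) (simp add: index_mult_mat_sum[of _ n n _ n] sum_distrib_left mult.assoc del: index_mult_mat(1))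
  finally show "mat_trace (\<rho> * X) = (\<Sum>i<n. \<Sum>j<n. p i * (mat_adjoint U * V) $$ (i, j) * x $$ (j, i))"
    by (simp add: W_def)
  have "\<rho> * (mat_adjoint X * X) = U * (?P * (mat_adjoint x * x)) * mat_adjoint U"
    unfolding Ud(2) X using Uc(1,2) Vc(1,2) x by (simp add: simps)
  then have "mat_trace (\<rho> * (mat_adjoint X * X)) = (\<Sum>i<n. p i * (mat_adjoint x * x) $$ (i, i))"
    using x Ud(1) by (simp add: mat_trace_unitary_conj mat_trace_diag_mult)
  also have "\<dots> = (\<Sum>i<n. \<Sum>j<n. complex_of_real (p i * (cmod (x $$ (j, i)))\<^sup>2))"
    using x by (intro sum.cong refl)
      (simp add: index_mult_mat_sum[of _ n n _ n] sum_distrib_left complex_norm_square mult_ac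
        del: index_mult_mat(1) of_real_power)
  finally show "mat_trace (\<rho> * (mat_adjoint X * X)) = complex_of_real (\<Sum>i<n. \<Sum>j<n. p i * (cmod (x $$ (j, i)))\<^sup>2)"
    by simp
  have "\<sigma> * (X * mat_adjoint X) = V * (?Q * (x * mat_adjoint x)) * mat_adjoint V"
    unfolding Vd(2) X using Uc(1,2) Vc(1,2) x by (simp add: simps)
  then have "mat_trace (\<sigma> * (X * mat_adjoint X)) = (\<Sum>j<n. q j * (x * mat_adjoint x) $$ (j, j))"
    using x Vd(1) by (simp add: mat_trace_unitary_conj mat_trace_diag_mult)
  also have "\<dots> = (\<Sum>j<n. \<Sum>i<n. complex_of_real (q j * (cmod (x $$ (j, i)))\<^sup>2))"
    using x by (intro sum.cong refl)
      (simp add: index_mult_mat_sum[of _ n n _ n] sum_distrib_left complex_norm_square mult_ac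
        del: index_mult_mat(1) of_real_power)
  also have "\<dots> = complex_of_real (\<Sum>i<n. \<Sum>j<n. q j * (cmod (x $$ (j, i)))\<^sup>2)"
    by (subst sum.swap) simp
  finally show "mat_trace (\<sigma> * (X * mat_adjoint X)) = complex_of_real (\<Sum>i<n. \<Sum>j<n. q j * (cmod (x $$ (j, i)))\<^sup>2)" .
qed

text \<open>
  In eigenbases \<open>u\<^sub>i\<close> of \<open>\<rho>\<close> and \<open>v\<^sub>j\<close> of \<open>\<sigma>\<close>, this is the quadratic form
  \<open>\<langle>\<rho>, (L\<^sub>\<sigma> + t R\<^sub>\<rho>)\<^sup>-\<^sup>1 \<rho>\<rangle>\<close> with \<open>L\<close>, \<open>R\<close> left and right multiplication.
  A term with \<open>q j + t * p i = 0\<close> has \<open>p i = 0\<close> and vanishes.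
\<close>

definition resolvent_form ::
    "nat \<Rightarrow> complex mat \<Rightarrow> (nat \<Rightarrow> real) \<Rightarrow> complex mat \<Rightarrow> (nat \<Rightarrow> real) \<Rightarrow> real \<Rightarrow> real" where
  "resolvent_form n U p V q t =
    (\<Sum>i<n. \<Sum>j<n. (cmod ((mat_adjoint U * V) $$ (i, j)))\<^sup>2 * ((p i)\<^sup>2 / (q j + t * p i)))"

text \<open>In the mixed bases the functional decouples into one scalar quadratic per pair of
  indices, and each is bounded by completing the square. If \<open>q j + t * p i\<close> is 0, then
  \<open>p i = 0\<close> and both sides of the scalar bound vanish.\<close>

lemma resolvent_form_ge:
  assumes U: "diagonalizes n U p \<rho>" and V: "diagonalizes n V q \<sigma>"
    and p: "\<And>i. i < n \<Longrightarrow> 0 \<le> p i" and q: "\<And>i. i < n \<Longrightarrow> 0 \<le> q i" and t: "0 < t"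
    and X: "X \<in> carrier_mat n n"
  shows "2 * Re (mat_trace (\<rho> * X)) - Re (mat_trace (\<sigma> * (X * mat_adjoint X)))
      - t * Re (mat_trace (\<rho> * (mat_adjoint X * X))) \<le> resolvent_form n U p V q t"
proof -
  note Uc = unitary_matD[OF diagonalizesD(1)[OF U]] and Vc = unitary_matD[OF diagonalizesD(1)[OF V]]
  define x where "x = mat_adjoint V * X * U"
  have x: "x \<in> carrier_mat n n" using Uc(1) Vc(2) X by (simp add: x_def)
  have Xx: "X = V * x * mat_adjoint U"
    using Uc Vc X unitary_cancel[OF diagonalizesD(1)[OF V], of _ n]
    by (simp add: x_def assoc_mult_mat[of _ n n _ n _ n] right_mult_one_mat[of _ n n])
  define W where "W = mat_adjoint U * V"
  have le: "2 * Re (p i * W $$ (i, j) * x $$ (j, i)) - q j * (cmod (x $$ (j, i)))\<^sup>2 - t * (p i * (cmod (x $$ (j, i)))\<^sup>2)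
      \<le> (cmod (W $$ (i, j)))\<^sup>2 * ((p i)\<^sup>2 / (q j + t * p i))" if "i < n" "j < n" for i j
  proof -
    define s a b where "s = q j + t * p i" and "a = cmod (x $$ (j, i))" and "b = cmod (W $$ (i, j))"
    have "0 \<le> s" using p q t that by (simp add: s_def)
    have "Re (p i * W $$ (i, j) * x $$ (j, i)) \<le> cmod (p i * W $$ (i, j) * x $$ (j, i))"
      by (rule complex_Re_le_cmod)
    also have "\<dots> = p i * b * a" using p that by (simp add: norm_mult a_def b_def)
    finally have 1: "Re (p i * W $$ (i, j) * x $$ (j, i)) \<le> p i * b * a" .
    have "2 * (p i * b * a) - s * a\<^sup>2 \<le> b\<^sup>2 * ((p i)\<^sup>2 / s)"
    proof (cases "s = 0")
      case True
      then have "t * p i = 0" using p q t that unfolding s_def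
        by (metis add_nonneg_eq_0_iff mult_nonneg_nonneg order_less_imp_le)
      then have "p i = 0" using t by simp
      then show ?thesis using True by simp
    next
      case False
      then have "0 < s" using \<open>0 \<le> s\<close> by simp
      have "0 \<le> (s * a - p i * b)\<^sup>2" by simp
      then have "s * (2 * (p i * b * a) - s * a\<^sup>2) \<le> b\<^sup>2 * (p i)\<^sup>2"
        by (simp add: power2_eq_square algebra_simps)
      then show ?thesis using \<open>0 < s\<close> by (simp add: pos_le_divide_eq mult.commute)
    qed
    with 1 show ?thesis by (simp add: s_def a_def b_def algebra_simps)
  qed
  have "2 * Re (mat_trace (\<rho> * X)) - Re (mat_trace (\<sigma> * (X * mat_adjoint X)))
      - t * Re (mat_trace (\<rho> * (mat_adjoint X * X))) =
    (\<Sum>i<n. \<Sum>j<n. 2 * Re (p i * W $$ (i, j) * x $$ (j, i)) - q j * (cmod (x $$ (j, i)))\<^sup>2 - t * (p i * (cmod (x $$ (j, i)))\<^sup>2))"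
    unfolding eigenbasis_traces[OF U V x Xx] Re_complex_of_real W_def[symmetric]
    by (simp add: sum_subtractf sum_distrib_left)
  also have "\<dots> \<le> resolvent_form n U p V q t"
    unfolding resolvent_form_def W_def[symmetric] using le by (intro sum_mono) auto
  finally show ?thesis .
qed

lemma resolvent_form_attained:
  assumes U: "diagonalizes n U p \<rho>" and V: "diagonalizes n V q \<sigma>"
    and p: "\<And>i. i < n \<Longrightarrow> 0 \<le> p i" and q: "\<And>i. i < n \<Longrightarrow> 0 \<le> q i" and t: "0 < t"
  obtains X where "X \<in> carrier_mat n n"
    "2 * Re (mat_trace (\<rho> * X)) - Re (mat_trace (\<sigma> * (X * mat_adjoint X)))
      - t * Re (mat_trace (\<rho> * (mat_adjoint X * X))) = resolvent_form n U p V q t"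
proof -
  note Uc = unitary_matD[OF diagonalizesD(1)[OF U]] and Vc = unitary_matD[OF diagonalizesD(1)[OF V]]
  define W where "W = mat_adjoint U * V"
  \<comment> \<open>The maximizer of each scalar quadratic. A zero denominator gives the entry 0 by
    the convention for division.\<close>
  define x where "x = mat n n (\<lambda>(j, i). complex_of_real (p i / (q j + t * p i)) * cnj (W $$ (i, j)))"
  define X where "X = V * x * mat_adjoint U"
  have x: "x \<in> carrier_mat n n" by (simp add: x_def)
  have eq: "2 * Re (p i * W $$ (i, j) * x $$ (j, i)) - q j * (cmod (x $$ (j, i)))\<^sup>2 - t * (p i * (cmod (x $$ (j, i)))\<^sup>2)
      = (cmod (W $$ (i, j)))\<^sup>2 * ((p i)\<^sup>2 / (q j + t * p i))" if "i < n" "j < n" for i j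
  proof -
    define s b where "s = q j + t * p i" and "b = (cmod (W $$ (i, j)))\<^sup>2"
    have xji: "x $$ (j, i) = complex_of_real (p i / s) * cnj (W $$ (i, j))"
      using that by (simp add: x_def s_def)
    have "p i * W $$ (i, j) * x $$ (j, i) = complex_of_real (p i * (p i / s)) * (W $$ (i, j) * cnj (W $$ (i, j)))"
      by (simp add: xji)
    also have "\<dots> = complex_of_real (p i * (p i / s) * b)"
      unfolding b_def complex_norm_square[symmetric] by (simp only: of_real_mult)
    finally have 1: "Re (p i * W $$ (i, j) * x $$ (j, i)) = p i * (p i / s) * b" by simp
    have 2: "(cmod (x $$ (j, i)))\<^sup>2 = (p i / s)\<^sup>2 * b"
      by (simp add: xji norm_mult norm_divide power_mult_distrib power_divide b_def)
    have "2 * (p i * (p i / s) * b) - s * ((p i / s)\<^sup>2 * b) = b * ((p i)\<^sup>2 / s)"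
      by (cases "s = 0") (simp_all add: power2_eq_square field_simps)
    then show ?thesis unfolding 1 2 s_def[symmetric] b_def[symmetric]
      by (simp add: s_def algebra_simps)
  qed
  have "2 * Re (mat_trace (\<rho> * X)) - Re (mat_trace (\<sigma> * (X * mat_adjoint X)))
      - t * Re (mat_trace (\<rho> * (mat_adjoint X * X))) =
    (\<Sum>i<n. \<Sum>j<n. 2 * Re (p i * W $$ (i, j) * x $$ (j, i)) - q j * (cmod (x $$ (j, i)))\<^sup>2 - t * (p i * (cmod (x $$ (j, i)))\<^sup>2))"
    unfolding eigenbasis_traces[OF U V x X_def] Re_complex_of_real W_def[symmetric]
    by (simp add: sum_subtractf sum_distrib_left)
  also have "\<dots> = resolvent_form n U p V q t"
    unfolding resolvent_form_def W_def[symmetric] using eq by (intro sum.cong refl) auto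
  finally have val: "2 * Re (mat_trace (\<rho> * X)) - Re (mat_trace (\<sigma> * (X * mat_adjoint X)))
      - t * Re (mat_trace (\<rho> * (mat_adjoint X * X))) = resolvent_form n U p V q t" .
  have "X \<in> carrier_mat n n" using Uc Vc x by (simp add: X_def)
  then show ?thesis using val by (rule that)
qed

text \<open>Pulling the maximizer \<open>Y\<close> of the output functional back to \<open>X\<close>
  preserves the linear term, by duality, and does not increase the two subtracted terms. So
  \<open>X\<close> reaches on the input at least the maximum of the output.\<close>

lemma resolvent_form_mono:
  assumes \<Psi>: "quantum_channel m n \<Psi>" and \<rho>: "psd m \<rho>" and \<sigma>: "psd m \<sigma>"
    and U: "diagonalizes m U p \<rho>" and V: "diagonalizes m V q \<sigma>"
    and U': "diagonalizes n U' p' (\<Psi> \<rho>)" and V': "diagonalizes n V' q' (\<Psi> \<sigma>)"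
    and p: "\<And>i. i < m \<Longrightarrow> 0 \<le> p i" and q: "\<And>i. i < m \<Longrightarrow> 0 \<le> q i"
    and p': "\<And>i. i < n \<Longrightarrow> 0 \<le> p' i" and q': "\<And>i. i < n \<Longrightarrow> 0 \<le> q' i" and t: "0 < t"
  shows "resolvent_form n U' p' V' q' t \<le> resolvent_form m U p V q t"
proof -
  obtain Y where Y: "Y \<in> carrier_mat n n"
    and YQ: "2 * Re (mat_trace (\<Psi> \<rho> * Y)) - Re (mat_trace (\<Psi> \<sigma> * (Y * mat_adjoint Y)))
      - t * Re (mat_trace (\<Psi> \<rho> * (mat_adjoint Y * Y))) = resolvent_form n U' p' V' q' t"
    using resolvent_form_attained[OF U' V' p' q' t] by blast
  obtain X where Xc: "X \<in> carrier_mat m m"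
    and dual: "\<And>M. M \<in> carrier_mat m m \<Longrightarrow> mat_trace (\<Psi> M * Y) = mat_trace (M * X)"
    and XX: "\<And>\<rho>. psd m \<rho> \<Longrightarrow> Re (mat_trace (\<rho> * (X * mat_adjoint X))) \<le> Re (mat_trace (\<Psi> \<rho> * (Y * mat_adjoint Y)))"
      "\<And>\<rho>. psd m \<rho> \<Longrightarrow> Re (mat_trace (\<rho> * (mat_adjoint X * X))) \<le> Re (mat_trace (\<Psi> \<rho> * (mat_adjoint Y * Y)))"
    using channel_dual_schwarz[OF \<Psi> Y] by blast
  note X = dual[OF psd_carrier[OF \<rho>]] XX(1)[OF \<sigma>] XX(2)[OF \<rho>]
  have "t * Re (mat_trace (\<rho> * (mat_adjoint X * X))) \<le> t * Re (mat_trace (\<Psi> \<rho> * (mat_adjoint Y * Y)))"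
    using X(3) t by simp
  then show ?thesis
    using YQ X resolvent_form_ge[OF U V p q t Xc] by simp
qed

section \<open>From resolvents to logarithms\<close>

text \<open>Subtracting \<open>ln (q k)\<close> makes the primitive vanish at \<open>t = 0\<close>.
  Where \<open>q k\<close> is 0 the product \<open>c k * p k\<close> is 0 as well, so the value of
  \<open>ln 0\<close> has no influence.\<close>

lemma log_primitive_DERIV:
  fixes c p q :: "'a \<Rightarrow> real"
  assumes K: "\<And>k. k \<in> K \<Longrightarrow> 0 \<le> c k \<and> 0 \<le> p k \<and> 0 \<le> q k \<and> (q k = 0 \<longrightarrow> c k * p k = 0)" and "0 \<le> t"
  shows "((\<lambda>t. \<Sum>k\<in>K. c k * p k * (ln (q k + t * p k) - ln (q k))) has_real_derivative
    (\<Sum>k\<in>K. c k * ((p k)\<^sup>2 / (q k + t * p k)))) (at t)"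
proof (rule DERIV_sum)
  fix k assume k: "k \<in> K"
  show "((\<lambda>t. c k * p k * (ln (q k + t * p k) - ln (q k))) has_real_derivative
      c k * ((p k)\<^sup>2 / (q k + t * p k))) (at t)"
  proof (cases "c k * p k = 0")
    case False
    then have "0 < q k" "0 \<le> t * p k" using K[OF k] assms(2) by auto
    then have "0 < q k + t * p k" by simp
    then show ?thesis
      by (auto intro!: derivative_eq_intros simp: power2_eq_square)
  qed (auto simp: power2_eq_square)
qed

text \<open>Since \<open>ln (q k + t * p k) - ln t = ln (q k / t + p k)\<close>, every term of
  nonzero weight diverges like \<open>ln t\<close>; subtracting the total weight times
  \<open>ln t\<close> leaves a finite limit.\<close>

lemma log_primitive_limit:
  fixes c p q :: "'a \<Rightarrow> real"
  assumes K: "\<And>k. k \<in> K \<Longrightarrow> 0 \<le> c k \<and> 0 \<le> p k \<and> 0 \<le> q k \<and> (q k = 0 \<longrightarrow> c k * p k = 0)"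
  shows "((\<lambda>t. (\<Sum>k\<in>K. c k * p k * (ln (q k + t * p k) - ln (q k))) - (\<Sum>k\<in>K. c k * p k) * ln t)
    \<longlongrightarrow> (\<Sum>k\<in>K. c k * p k * (ln (p k) - ln (q k)))) at_top"
proof -
  have "((\<lambda>t. c k * p k * (ln (q k + t * p k) - ln t - ln (q k))) \<longlongrightarrow> c k * p k * (ln (p k) - ln (q k))) at_top"
    if k: "k \<in> K" for k
  proof (cases "c k * p k = 0")
    case False
    then have pos: "0 < p k" "0 < q k" using K[OF k] by (auto simp: less_le)
    have "((\<lambda>t. q k / t + p k) \<longlongrightarrow> 0 + p k) at_top"
      by (intro tendsto_intros tendsto_divide_0[OF tendsto_const] filterlim_at_top_imp_at_infinity filterlim_ident)
    then have "((\<lambda>t. ln (q k / t + p k)) \<longlongrightarrow> ln (p k)) at_top"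
      using pos by (intro tendsto_ln) auto
    moreover have "\<forall>\<^sub>F t in at_top. ln (q k / t + p k) = ln (q k + t * p k) - ln t"
      using eventually_gt_at_top[of 0]
    proof eventually_elim
      case (elim t)
      have "0 < q k + t * p k" using elim pos by (simp add: add_pos_pos)
      moreover have "q k / t + p k = (q k + t * p k) / t" using elim by (simp add: field_simps)
      ultimately show ?case using elim by (simp add: ln_div)
    qed
    ultimately have "((\<lambda>t. ln (q k + t * p k) - ln t) \<longlongrightarrow> ln (p k)) at_top"
      by (simp add: tendsto_cong)
    then show ?thesis by (intro tendsto_intros)
  next
    case True
    show ?thesis unfolding True by simp
  qed
  then have "((\<lambda>t. \<Sum>k\<in>K. c k * p k * (ln (q k + t * p k) - ln t - ln (q k)))
      \<longlongrightarrow> (\<Sum>k\<in>K. c k * p k * (ln (p k) - ln (q k)))) at_top"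
    by (rule tendsto_sum)
  moreover have "(\<Sum>k\<in>K. c k * p k * (ln (q k + t * p k) - ln t - ln (q k))) =
      (\<Sum>k\<in>K. c k * p k * (ln (q k + t * p k) - ln (q k))) - (\<Sum>k\<in>K. c k * p k) * ln t" for t
    unfolding sum_distrib_right sum_subtractf[symmetric] by (intro sum.cong) (simp_all add: algebra_simps)
  ultimately show ?thesis by simp
qed

text \<open>
  Since \<open>ln p - ln q = \<integral>\<^sub>0\<^sup>\<infinity> (p / (q + t p) - 1 / (1 + t)) dt\<close>, an inequality between the
  resolvent sums integrates to one between the logarithmic sums.
\<close>

lemma log_sum_mono:
  fixes c p q :: "'a \<Rightarrow> real" and c' p' q' :: "'b \<Rightarrow> real"
  assumes K: "\<And>k. k \<in> K \<Longrightarrow> 0 \<le> c k \<and> 0 \<le> p k \<and> 0 \<le> q k \<and> (q k = 0 \<longrightarrow> c k * p k = 0)"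
    and K': "\<And>k. k \<in> K' \<Longrightarrow> 0 \<le> c' k \<and> 0 \<le> p' k \<and> 0 \<le> q' k \<and> (q' k = 0 \<longrightarrow> c' k * p' k = 0)"
    and le: "\<And>t. 0 < t \<Longrightarrow> (\<Sum>k\<in>K'. c' k * ((p' k)\<^sup>2 / (q' k + t * p' k))) \<le> (\<Sum>k\<in>K. c k * ((p k)\<^sup>2 / (q k + t * p k)))"
    and eq: "(\<Sum>k\<in>K'. c' k * p' k) = (\<Sum>k\<in>K. c k * p k)"
  shows "(\<Sum>k\<in>K'. c' k * p' k * (ln (p' k) - ln (q' k))) \<le> (\<Sum>k\<in>K. c k * p k * (ln (p k) - ln (q k)))"
proof -
  define F where "F t = (\<Sum>k\<in>K. c k * p k * (ln (q k + t * p k) - ln (q k)))" for t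
  define F' where "F' t = (\<Sum>k\<in>K'. c' k * p' k * (ln (q' k + t * p' k) - ln (q' k)))" for t
  note dF = log_primitive_DERIV[of K c p q, OF K, folded F_def]
  note dF' = log_primitive_DERIV[of K' c' p' q', OF K', folded F'_def]
  note d = DERIV_diff[OF dF dF']
  have "0 \<le> F t - F' t" if "0 < t" for t
  proof -
    \<comment> \<open>Both primitives start at 0, so the ordering of their derivatives orders the
      primitives at every later \<open>t\<close>.\<close>
    have "F 0 - F' 0 \<le> F t - F' t"
    proof (rule DERIV_nonneg_imp_increasing_open[of 0 t "\<lambda>t. F t - F' t"])
      show "\<exists>y. ((\<lambda>t. F t - F' t) has_real_derivative y) (at x) \<and> 0 \<le> y" if "0 < x" for x
        using d[of x] le[OF that] that by (intro exI conjI) auto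
      show "continuous_on {0..t} (\<lambda>t. F t - F' t)"
        using d DERIV_isCont by (intro continuous_at_imp_continuous_on) fastforce
    qed (use that in auto)
    then show ?thesis by (simp add: F_def F'_def)
  qed
  then have ev: "\<forall>\<^sub>F t in at_top. 0 \<le> F t - F' t"
    by (rule eventually_mono[OF eventually_gt_at_top[of 0]])
  have "((\<lambda>t. (F t - (\<Sum>k\<in>K. c k * p k) * ln t) - (F' t - (\<Sum>k\<in>K'. c' k * p' k) * ln t)) \<longlongrightarrow>
      (\<Sum>k\<in>K. c k * p k * (ln (p k) - ln (q k))) - (\<Sum>k\<in>K'. c' k * p' k * (ln (p' k) - ln (q' k)))) at_top"
    unfolding F_def F'_def
    using log_primitive_limit[of K c p q, OF K] log_primitive_limit[of K' c' p' q', OF K']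
    by (intro tendsto_diff) auto
  \<comment> \<open>The two \<open>ln t\<close> corrections have equal coefficients by
    \<open>eq\<close> and cancel, so the difference itself converges.\<close>
  then have "((\<lambda>t. F t - F' t) \<longlongrightarrow>
      (\<Sum>k\<in>K. c k * p k * (ln (p k) - ln (q k))) - (\<Sum>k\<in>K'. c' k * p' k * (ln (p' k) - ln (q' k)))) at_top"
    by (simp add: eq)
  from tendsto_lowerbound[OF this ev] show ?thesis by simp
qed

text \<open>The entropy of \<open>\<rho>\<close> is a single sum over \<open>i\<close>; as every row
  of squared overlaps sums to 1, it can be spread over \<open>j\<close> with the same weights as the
  term with \<open>\<sigma>\<close>.\<close>

lemma relative_entropy_eigenbases:
  assumes U: "diagonalizes n U p \<rho>" and V: "diagonalizes n V q \<sigma>"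
  shows "Re (mat_trace (\<rho> * mat_log2 \<rho>) - mat_trace (\<rho> * mat_log2 \<sigma>)) =
    (\<Sum>i<n. \<Sum>j<n. (cmod ((mat_adjoint U * V) $$ (i, j)))\<^sup>2 * p i * (ln (p i) - ln (q j))) / ln 2"
proof -
  note Ud = diagonalizesD[OF U] and Vd = diagonalizesD[OF V]
  define W where "W = mat_adjoint U * V"
  have W: "unitary_mat n W" using unitary_mult unitary_adjoint Ud(1) Vd(1) by (simp add: W_def)
  have "mat_trace (\<rho> * mat_log2 \<sigma>) =
      complex_of_real (\<Sum>i<n. \<Sum>j<n. (cmod (W $$ (i, j)))\<^sup>2 * p i * log 2 (q j))"
    unfolding mat_log2_eq[OF V]
    by (subst Ud(2)) (use unitary_matD(1)[OF Ud(1)] unitary_matD(1)[OF Vd(1)] in \<open>simp add: mat_trace_two_diags W_def\<close>)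
  moreover have "- entropy \<rho> = (\<Sum>i<n. \<Sum>j<n. (cmod (W $$ (i, j)))\<^sup>2 * p i * log 2 (p i))"
    using unitary_row_sum[OF W] unfolding entropy_eq[OF U]
    by (simp add: sum_distrib_right[symmetric])
  ultimately have "Re (mat_trace (\<rho> * mat_log2 \<rho>) - mat_trace (\<rho> * mat_log2 \<sigma>)) =
      (\<Sum>i<n. \<Sum>j<n. (cmod (W $$ (i, j)))\<^sup>2 * p i * log 2 (p i)) -
      (\<Sum>i<n. \<Sum>j<n. (cmod (W $$ (i, j)))\<^sup>2 * p i * log 2 (q j))"
    by (simp add: entropy_def)
  then show ?thesis
    unfolding W_def[symmetric]
    by (simp add: sum_subtractf[symmetric] sum_divide_distrib log_def right_diff_distrib diff_divide_distrib)
qed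

text \<open>Column \<open>j\<close> of \<open>V\<close> lies in the kernel of
  \<open>\<sigma>\<close>, hence of \<open>\<rho>\<close>, and \<open>p i\<close> times the overlap
  is the coordinate of its image under \<open>\<rho>\<close> along column \<open>i\<close> of
  \<open>U\<close>.\<close>

lemma eigenbasis_support:
  assumes U: "diagonalizes n U p \<rho>" and V: "diagonalizes n V q \<sigma>"
    and ker: "mat_kernel \<sigma> \<subseteq> mat_kernel \<rho>" and ij: "i < n" "j < n" and q: "q j = 0"
  shows "(cmod ((mat_adjoint U * V) $$ (i, j)))\<^sup>2 * p i = 0"
proof -
  note Ud = diagonalizesD[OF U] and Vd = diagonalizesD[OF V]
  note Uc = unitary_matD[OF Ud(1)] and Vc = unitary_matD[OF Vd(1)]
  let ?P = "mat_diag n (\<lambda>i. complex_of_real (p i))" and ?Q = "mat_diag n (\<lambda>i. complex_of_real (q i))"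
  have \<sigma>V: "\<sigma> * V = V * ?Q"
    unfolding Vd(2) using Vc by (simp add: assoc_mult_mat[of _ n n _ n _ n] right_mult_one_mat[of _ n n])
  have "\<sigma> *\<^sub>v col V j = col (\<sigma> * V) j"
    using col_mult2[OF diagonalizes_carrier[OF V] Vc(1) ij(2)] by (rule sym)
  also have "\<dots> = 0\<^sub>v n"
    unfolding \<sigma>V mat_diag_mult_right[OF Vc(1)] using ij q by (intro eq_vecI) auto
  finally have "col V j \<in> mat_kernel \<sigma>"
    using Vc diagonalizes_carrier[OF V] by (auto simp: mat_kernel_def)
  then have "\<rho> *\<^sub>v col V j = 0\<^sub>v n"
    using ker diagonalizes_carrier[OF U] by (auto simp: mat_kernel_def)
  with col_mult2[OF diagonalizes_carrier[OF U] Vc(1) ij(2)] have z: "col (\<rho> * V) j = 0\<^sub>v n"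
    by (rule trans)
  have "?P * (mat_adjoint U * V) = mat_adjoint U * (\<rho> * V)"
    unfolding Ud(2) using Uc Vc unitary_cancel[OF Ud(1), of _ n]
    by (simp add: assoc_mult_mat[of _ n n _ n _ n])
  then have "(?P * (mat_adjoint U * V)) $$ (i, j) = row (mat_adjoint U) i \<bullet> col (\<rho> * V) j"
    using Uc Vc ij diagonalizes_carrier[OF U] by simp
  also have "\<dots> = 0" unfolding z using Uc ij by simp
  finally have "p i * (mat_adjoint U * V) $$ (i, j) = 0"
    using Uc Vc ij by (simp add: mat_diag_mult_left[of _ n n])
  then show ?thesis by auto
qed

text \<open>This sum is the coefficient of \<open>ln t\<close> in the primitives, so trace
  preservation makes the divergent parts of input and output equal.\<close>

lemma mat_trace_eq_weighted_sum:
  assumes U: "diagonalizes n U p \<rho>" and V: "unitary_mat n V"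
  shows "mat_trace \<rho> = complex_of_real (\<Sum>i<n. \<Sum>j<n. (cmod ((mat_adjoint U * V) $$ (i, j)))\<^sup>2 * p i)"
proof -
  note Ud = diagonalizesD[OF U]
  have "unitary_mat n (mat_adjoint U * V)" using unitary_mult unitary_adjoint Ud(1) V by simp
  then have "(\<Sum>i<n. \<Sum>j<n. (cmod ((mat_adjoint U * V) $$ (i, j)))\<^sup>2 * p i) = (\<Sum>i<n. p i)"
    using unitary_row_sum by (intro sum.cong refl) (simp add: sum_distrib_right[symmetric])
  moreover have "mat_trace \<rho> = (\<Sum>i<n. complex_of_real (p i))"
    by (subst Ud(2), subst mat_trace_unitary_conj[OF Ud(1)]) (simp_all add: mat_trace_def)
  ultimately show ?thesis by simp
qed

theorem relative_entropy_mono: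
  assumes \<Psi>: "quantum_channel m n \<Psi>" and \<rho>: "psd m \<rho>" and \<sigma>: "psd m \<sigma>"
    and \<rho>': "psd n (\<Psi> \<rho>)" and \<sigma>': "psd n (\<Psi> \<sigma>)"
    and ker: "mat_kernel \<sigma> \<subseteq> mat_kernel \<rho>" and ker': "mat_kernel (\<Psi> \<sigma>) \<subseteq> mat_kernel (\<Psi> \<rho>)"
  shows "Re (mat_trace (\<Psi> \<rho> * mat_log2 (\<Psi> \<rho>)) - mat_trace (\<Psi> \<rho> * mat_log2 (\<Psi> \<sigma>))) \<le>
    Re (mat_trace (\<rho> * mat_log2 \<rho>) - mat_trace (\<rho> * mat_log2 \<sigma>))"
proof -
  obtain U p where U: "diagonalizes m U p \<rho>" and p: "\<And>i. i < m \<Longrightarrow> 0 \<le> p i"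
    using psd_diagonalizable[OF \<rho>] by blast
  obtain V q where V: "diagonalizes m V q \<sigma>" and q: "\<And>i. i < m \<Longrightarrow> 0 \<le> q i"
    using psd_diagonalizable[OF \<sigma>] by blast
  obtain U' p' where U': "diagonalizes n U' p' (\<Psi> \<rho>)" and p': "\<And>i. i < n \<Longrightarrow> 0 \<le> p' i"
    using psd_diagonalizable[OF \<rho>'] by blast
  obtain V' q' where V': "diagonalizes n V' q' (\<Psi> \<sigma>)" and q': "\<And>i. i < n \<Longrightarrow> 0 \<le> q' i"
    using psd_diagonalizable[OF \<sigma>'] by blast
  define c where "c k = (cmod ((mat_adjoint U * V) $$ k))\<^sup>2" for k
  define c' where "c' k = (cmod ((mat_adjoint U' * V') $$ k))\<^sup>2" for k
  have "(\<Sum>k\<in>{..<n} \<times> {..<n}. c' k * p' (fst k) * (ln (p' (fst k)) - ln (q' (snd k)))) \<le>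
    (\<Sum>k\<in>{..<m} \<times> {..<m}. c k * p (fst k) * (ln (p (fst k)) - ln (q (snd k))))"
  proof (rule log_sum_mono)
    fix k assume k: "k \<in> {..<m} \<times> {..<m}"
    then show "0 \<le> c k \<and> 0 \<le> p (fst k) \<and> 0 \<le> q (snd k) \<and> (q (snd k) = 0 \<longrightarrow> c k * p (fst k) = 0)"
      using p q eigenbasis_support[OF U V ker, of "fst k" "snd k"] by (auto simp: c_def)
  next
    fix k assume k: "k \<in> {..<n} \<times> {..<n}"
    then show "0 \<le> c' k \<and> 0 \<le> p' (fst k) \<and> 0 \<le> q' (snd k) \<and> (q' (snd k) = 0 \<longrightarrow> c' k * p' (fst k) = 0)"
      using p' q' eigenbasis_support[OF U' V' ker', of "fst k" "snd k"] by (auto simp: c'_def)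
  next
    fix t :: real assume "0 < t"
    from resolvent_form_mono[OF \<Psi> \<rho> \<sigma> U V U' V' p q p' q' this]
    show "(\<Sum>k\<in>{..<n} \<times> {..<n}. c' k * ((p' (fst k))\<^sup>2 / (q' (snd k) + t * p' (fst k)))) \<le>
      (\<Sum>k\<in>{..<m} \<times> {..<m}. c k * ((p (fst k))\<^sup>2 / (q (snd k) + t * p (fst k))))"
      unfolding resolvent_form_def sum.cartesian_product c_def c'_def by (simp add: case_prod_beta)
  next
    have "mat_trace (\<Psi> \<rho>) = mat_trace \<rho>"
      using quantum_channelD(4)[OF \<Psi> psd_carrier[OF \<rho>]] .
    then show "(\<Sum>k\<in>{..<n} \<times> {..<n}. c' k * p' (fst k)) = (\<Sum>k\<in>{..<m} \<times> {..<m}. c k * p (fst k))"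
      unfolding mat_trace_eq_weighted_sum[OF U diagonalizesD(1)[OF V]]
        mat_trace_eq_weighted_sum[OF U' diagonalizesD(1)[OF V']] sum.cartesian_product c_def c'_def
      by (simp add: case_prod_beta del: of_real_sum)
  qed
  then show ?thesis
    unfolding relative_entropy_eigenbases[OF U V] relative_entropy_eigenbases[OF U' V']
      sum.cartesian_product c_def c'_def
    by (intro divide_right_mono) (simp_all add: case_prod_beta)
qed

section \<open>Tensoring with the identity channel\<close>

lemma pair_index_less: "a < m \<Longrightarrow> b < k \<Longrightarrow> a * k + b < m * (k :: nat)"
proof -
  assume "a < m" "b < k"
  then have "a * k + b < Suc a * k" by simp
  also have "\<dots> \<le> m * k" using \<open>a < m\<close> by (intro mult_le_mono1) simp
  finally show ?thesis .
qed

lemma sum_residue: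
  fixes f :: "nat \<Rightarrow> 'a::comm_monoid_add"
  assumes "r < k"
  shows "(\<Sum>i<m * k. if i mod k = r then f i else 0) = (\<Sum>a<m. f (a * k + r))"
proof -
  have "(\<Sum>i<m * k. if i mod k = r then f i else 0) = (\<Sum>a<m. \<Sum>b<k. if b = r then f (a * k + r) else 0)"
    unfolding sum_lessThan_mult by (intro sum.cong refl) auto
  then show ?thesis using assms by simp
qed

lemma index_tensor_id:
  assumes "a < n" "b < k" "a' < n" "b' < k"
  shows "tensor_id m n k \<Phi> M $$ (a * k + b, a' * k + b') = \<Phi> (partial_block m k M b b') $$ (a, a')"
  using assms by (simp add: tensor_id_def pair_index_less)

lemma tensor_id_carrier [simp]: "tensor_id m n k \<Phi> M \<in> carrier_mat (n * k) (n * k)"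
  by (simp add: tensor_id_def)

lemma partial_block_carrier [simp]: "partial_block m k M b b' \<in> carrier_mat m m"
  by (simp add: partial_block_def)

text \<open>Associativity of the tensor product: a pair of ancilla indices \<open>b\<close>,
  \<open>s\<close> is read as the single index \<open>b * l + s\<close>. It reduces complete
  positivity of the extended map to that of \<open>\<Phi>\<close>.\<close>

lemma tensor_id_tensor_id:
  "tensor_id (m * k) (n * k) l (tensor_id m n k \<Phi>) M = tensor_id m n (k * l) \<Phi> M"
proof (rule eq_matI)
  fix i j assume "i < dim_row (tensor_id m n (k * l) \<Phi> M)" "j < dim_col (tensor_id m n (k * l) \<Phi> M)"
  then have ij: "i < n * k * l" "j < n * k * l" by (auto simp: tensor_id_def mult.assoc)
  then have pos: "0 < k" "0 < l" by (auto intro: Nat.gr0I)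
  have dl: "i div l < n * k" "j div l < n * k"
    using ij by (auto simp: less_mult_imp_div_less)
  have pb: "partial_block m k (partial_block (m * k) l M s s') b b' = partial_block m (k * l) M (b * l + s) (b' * l + s')"
    if "b < k" "b' < k" for s s' b b'
    using that by (intro eq_matI) (auto simp: partial_block_def pair_index_less add_mult_distrib mult.assoc add.assoc)
  have md: "x mod (k * l) = x div l mod k * l + x mod l" for x
    using mod_mult2_eq[of x l k] by (simp add: mult.commute)
  have dv: "x div (k * l) = x div l div k" for x
    using div_mult2_eq[of x l k] by (simp add: mult.commute)
  show "tensor_id (m * k) (n * k) l (tensor_id m n k \<Phi>) M $$ (i, j) = tensor_id m n (k * l) \<Phi> M $$ (i, j)"
    using ij dl pos by (simp add: tensor_id_def md dv pb mult.assoc)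
qed (simp_all add: tensor_id_def mult.assoc)

lemma tensor_id_one:
  assumes "linear_superop m n \<Phi>" "M \<in> carrier_mat m m"
  shows "tensor_id m n 1 \<Phi> M = \<Phi> M"
proof -
  have "partial_block m 1 M 0 0 = M" using assms by (intro eq_matI) (auto simp: partial_block_def)
  moreover have "\<Phi> M \<in> carrier_mat n n" using assms by (simp add: linear_superop_def)
  ultimately show ?thesis by (intro eq_matI) (auto simp: tensor_id_def)
qed

lemma quantum_channel_psd:
  assumes "quantum_channel m n \<Phi>" "psd m \<rho>"
  shows "psd n (\<Phi> \<rho>)"
  using quantum_channelD(5)[OF assms(1), of 1 \<rho>] assms tensor_id_one[of m n \<Phi> \<rho>] psd_carrier[of m \<rho>]
  by (simp add: quantum_channel_def)

lemma mat_trace_blocks: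
  assumes "M \<in> carrier_mat (m * k) (m * k)"
  shows "mat_trace M = (\<Sum>b<k. mat_trace (partial_block m k M b b))"
proof -
  have "mat_trace M = (\<Sum>a<m. \<Sum>b<k. M $$ (a * k + b, a * k + b))"
    using assms by (simp add: mat_trace_def sum_lessThan_mult)
  then show ?thesis by (subst (asm) sum.swap) (simp add: mat_trace_def partial_block_def)
qed

lemma partial_block_tensor_id:
  assumes "linear_superop m n \<Phi>" "b < k" "b' < k"
  shows "partial_block n k (tensor_id m n k \<Phi> M) b b' = \<Phi> (partial_block m k M b b')"
proof -
  have "\<Phi> (partial_block m k M b b') \<in> carrier_mat n n"
    using assms by (simp add: linear_superop_def)
  then show ?thesis
    using assms by (intro eq_matI) (auto simp: partial_block_def[of n] index_tensor_id)
qed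

text \<open>Monotonicity is applied to the extended map, which therefore has to be a channel in its
  own right. An ancilla of dimension \<open>l\<close> for it is one of dimension
  \<open>k * l\<close> for \<open>\<Phi>\<close>, and the trace is preserved block by block.\<close>

theorem quantum_channel_tensor_id:
  assumes \<Phi>: "quantum_channel m n \<Phi>" and k: "1 \<le> k"
  shows "quantum_channel (m * k) (n * k) (tensor_id m n k \<Phi>)"
proof -
  note \<Phi>D = quantum_channelD[OF \<Phi>]
  have lin: "linear_superop m n \<Phi>" using \<Phi> by (simp add: quantum_channel_def)
  have c: "\<Phi> (partial_block m k X b b') \<in> carrier_mat n n" for X b b' by (rule \<Phi>D(1)) simp
  have res: "i div k < n \<and> i mod k < k" if "i < n * k" for i
    using that k by (simp add: less_mult_imp_div_less)
  have "linear_superop (m * k) (n * k) (tensor_id m n k \<Phi>)"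
    unfolding linear_superop_def
  proof (intro conjI ballI allI)
    fix X Y :: "complex mat" assume X: "X \<in> carrier_mat (m * k) (m * k)" and Y: "Y \<in> carrier_mat (m * k) (m * k)"
    have "partial_block m k (X + Y) b b' = partial_block m k X b b' + partial_block m k Y b b'"
      if "b < k" "b' < k" for b b'
      using that X Y by (intro eq_matI) (auto simp: partial_block_def pair_index_less)
    then show "tensor_id m n k \<Phi> (X + Y) = tensor_id m n k \<Phi> X + tensor_id m n k \<Phi> Y"
      using res by (intro eq_matI) (auto simp: tensor_id_def \<Phi>D(2) carrier_matD[OF c])
  next
    fix c' :: complex and X :: "complex mat" assume X: "X \<in> carrier_mat (m * k) (m * k)"
    have "partial_block m k (c' \<cdot>\<^sub>m X) b b' = c' \<cdot>\<^sub>m partial_block m k X b b'" if "b < k" "b' < k" for b b'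
      using that X by (intro eq_matI) (auto simp: partial_block_def pair_index_less)
    then show "tensor_id m n k \<Phi> (c' \<cdot>\<^sub>m X) = c' \<cdot>\<^sub>m tensor_id m n k \<Phi> X"
      using res by (intro eq_matI) (auto simp: tensor_id_def \<Phi>D(3) carrier_matD[OF c])
  qed simp
  moreover have "completely_positive (m * k) (n * k) (tensor_id m n k \<Phi>)"
    unfolding completely_positive_def tensor_id_tensor_id
    using \<Phi>D(5)[of "k * _"] k by (auto simp: mult.assoc)
  moreover have "trace_preserving (m * k) (tensor_id m n k \<Phi>)"
    unfolding trace_preserving_def
  proof
    fix X :: "complex mat" assume X: "X \<in> carrier_mat (m * k) (m * k)"
    have "mat_trace (tensor_id m n k \<Phi> X) = (\<Sum>b<k. mat_trace (\<Phi> (partial_block m k X b b)))"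
      by (subst mat_trace_blocks[of _ n k]) (auto simp: partial_block_tensor_id[OF lin])
    also have "\<dots> = mat_trace X"
      unfolding mat_trace_blocks[OF X] by (intro sum.cong refl \<Phi>D(4)) simp
    finally show "mat_trace (tensor_id m n k \<Phi> X) = mat_trace X" .
  qed
  ultimately show ?thesis by (simp add: quantum_channel_def)
qed

section \<open>Dephasing of the second factor\<close>

text \<open>The index of the second factor is the residue modulo \<open>k\<close>, so this is the
  pinching onto the diagonal blocks.\<close>

definition dephase_second :: "nat \<Rightarrow> complex mat \<Rightarrow> complex mat" where
  "dephase_second k M = mat (dim_row M) (dim_col M) (\<lambda>(i, j). if i mod k = j mod k then M $$ (i, j) else 0)"

lemma dephase_second_carrier [simp]:
  "M \<in> carrier_mat n n \<Longrightarrow> dephase_second k M \<in> carrier_mat n n"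
  by (simp add: dephase_second_def)

lemma index_dephase_second:
  "M \<in> carrier_mat n n \<Longrightarrow> i < n \<Longrightarrow> j < n \<Longrightarrow>
    dephase_second k M $$ (i, j) = (if i mod k = j mod k then M $$ (i, j) else 0)"
  by (simp add: dephase_second_def)

lemma partial_block_dephase_second:
  assumes "M \<in> carrier_mat (m * k) (m * k)" "b < k" "b' < k"
  shows "partial_block m k (dephase_second k M) b b' = (if b = b' then partial_block m k M b b else 0\<^sub>m m m)"
  using assms by (intro eq_matI) (auto simp: partial_block_def dephase_second_def pair_index_less)

text \<open>The extended map treats each block separately and sends zero blocks to zero, so the
  off-diagonal blocks may be deleted before or after it.\<close>

lemma tensor_id_dephase_second:
  assumes lin: "linear_superop m n \<Phi>" and M: "M \<in> carrier_mat (m * k) (m * k)"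
  shows "tensor_id m n k \<Phi> (dephase_second k M) = dephase_second k (tensor_id m n k \<Phi> M)"
proof -
  have z: "\<Phi> (0\<^sub>m m m) = 0\<^sub>m n n"
  proof -
    have c: "\<Phi> (0\<^sub>m m m) \<in> carrier_mat n n" using lin by (simp add: linear_superop_def)
    have "\<Phi> (0 \<cdot>\<^sub>m 0\<^sub>m m m) = 0 \<cdot>\<^sub>m \<Phi> (0\<^sub>m m m)"
      using lin zero_carrier_mat[of m m] unfolding linear_superop_def by blast
    moreover have "0 \<cdot>\<^sub>m \<Phi> (0\<^sub>m m m) = 0\<^sub>m n n" by (intro eq_matI) (use c in auto)
    ultimately show ?thesis by simp
  qed
  show ?thesis
  proof (rule eq_matI)
    fix i j assume "i < dim_row (dephase_second k (tensor_id m n k \<Phi> M))"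
      "j < dim_col (dephase_second k (tensor_id m n k \<Phi> M))"
    then have ij: "i < n * k" "j < n * k" by (auto simp: dephase_second_def tensor_id_def)
    then have "0 < k" by (auto intro: Nat.gr0I)
    then show "tensor_id m n k \<Phi> (dephase_second k M) $$ (i, j) = dephase_second k (tensor_id m n k \<Phi> M) $$ (i, j)"
      using ij
      by (subst index_dephase_second[OF tensor_id_carrier])
        (simp_all add: tensor_id_def partial_block_dephase_second[OF M] z less_mult_imp_div_less)
  qed (simp_all add: dephase_second_def tensor_id_def)
qed

lemma quad_form_residue:
  assumes "b < k"
  shows "quad_form (m * k) M (\<lambda>i. if i mod k = b then v i else 0) =
    quad_form m (partial_block m k M b b) (\<lambda>a. v (a * k + b))"
proof -
  have "quad_form (m * k) M (\<lambda>i. if i mod k = b then v i else 0) =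
      (\<Sum>i<m * k. if i mod k = b then (\<Sum>j<m * k. if j mod k = b then cnj (v i) * M $$ (i, j) * v j else 0) else 0)"
    unfolding quad_form_def by (intro sum.cong refl) (auto intro!: sum.cong)
  then show ?thesis
    using assms by (simp add: sum_residue quad_form_def partial_block_def)
qed

lemma psd_partial_block:
  assumes "psd (m * k) M" "b < k"
  shows "psd m (partial_block m k M b b)"
  unfolding psd_iff_quad_form
proof (intro conjI allI)
  fix v
  have "quad_form m (partial_block m k M b b) v =
      quad_form m (partial_block m k M b b) (\<lambda>a. v ((a * k + b) div k))"
    using assms(2) by (intro quad_form_cong) auto
  also have "\<dots> = quad_form (m * k) M (\<lambda>i. if i mod k = b then v (i div k) else 0)"
    using quad_form_residue[OF assms(2), of m M "\<lambda>i. v (i div k)"] by simp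
  finally show "0 \<le> quad_form m (partial_block m k M b b) v"
    using assms(1) by (simp add: psd_iff_quad_form)
qed simp

text \<open>An eigenbasis of a block diagonal matrix is the union of eigenbases of its blocks:
  column \<open>i\<close> belongs to block \<open>i mod k\<close> and is eigenvector number
  \<open>i div k\<close> there.\<close>

lemma diagonalizes_dephase_second:
  assumes M: "M \<in> carrier_mat (m * k) (m * k)"
    and d: "\<And>b. b < k \<Longrightarrow> diagonalizes m (U b) (d b) (partial_block m k M b b)"
  shows "diagonalizes (m * k)
      (mat (m * k) (m * k) (\<lambda>(i, j). if i mod k = j mod k then U (i mod k) $$ (i div k, j div k) else 0))
      (\<lambda>i. d (i mod k) (i div k)) (dephase_second k M)"
    (is "diagonalizes _ ?V ?e _")
proof -
  have U: "unitary_mat m (U b)" "partial_block m k M b b = U b * mat_diag m (\<lambda>i. complex_of_real (d b i)) * mat_adjoint (U b)"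
    if "b < k" for b
    using diagonalizesD[OF d[OF that]] by simp_all
  note Uc = unitary_matD[OF U(1)]
  have V: "?V \<in> carrier_mat (m * k) (m * k)" by simp
  have "mat_adjoint ?V * ?V = 1\<^sub>m (m * k)"
  proof (rule eq_matI)
    fix i j assume "i < dim_row (1\<^sub>m (m * k) :: complex mat)" "j < dim_col (1\<^sub>m (m * k) :: complex mat)"
    then have ij: "i < m * k" "j < m * k" by auto
    then have k: "0 < k" by (auto intro: Nat.gr0I)
    have r: "i mod k < k" "i div k < m" "j mod k < k" "j div k < m" using ij k by (auto simp: less_mult_imp_div_less)
    have "(mat_adjoint ?V * ?V) $$ (i, j) = (\<Sum>l<m * k. if l mod k = i mod k then
        (if i mod k = j mod k then cnj (U (i mod k) $$ (l div k, i div k)) * U (i mod k) $$ (l div k, j div k) else 0) else 0)"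
      using ij by (subst index_mult_mat_sum[of _ "m * k" "m * k" _ "m * k"]) (auto intro!: sum.cong)
    also have "\<dots> = (if i mod k = j mod k then
        (\<Sum>a<m. cnj (U (i mod k) $$ (a, i div k)) * U (i mod k) $$ (a, j div k)) else 0)"
      using r by (simp add: sum_residue)
    also have "(\<Sum>a<m. cnj (U (i mod k) $$ (a, i div k)) * U (i mod k) $$ (a, j div k)) =
        (mat_adjoint (U (i mod k)) * U (i mod k)) $$ (i div k, j div k)"
      using r Uc(1,2)[OF r(1)] by (subst index_mult_mat_sum[of _ m m _ m]) auto
    also have "\<dots> = (if i div k = j div k then 1 else 0)"
      unfolding Uc(4)[OF r(1)] using r by simp
    finally show "(mat_adjoint ?V * ?V) $$ (i, j) = 1\<^sub>m (m * k) $$ (i, j)"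
      using ij by (simp split: if_splits) (metis div_mult_mod_eq)
  qed auto
  then have "unitary_mat (m * k) ?V" using V by (intro unitary_matI)
  moreover have "dephase_second k M = ?V * mat_diag (m * k) (\<lambda>i. complex_of_real (?e i)) * mat_adjoint ?V"
  proof (rule eq_matI)
    fix i j assume "i < dim_row (?V * mat_diag (m * k) (\<lambda>i. complex_of_real (?e i)) * mat_adjoint ?V)"
      "j < dim_col (?V * mat_diag (m * k) (\<lambda>i. complex_of_real (?e i)) * mat_adjoint ?V)"
    then have ij: "i < m * k" "j < m * k" by auto
    then have k: "0 < k" by (auto intro: Nat.gr0I)
    have r: "i mod k < k" "i div k < m" "j mod k < k" "j div k < m" using ij k by (auto simp: less_mult_imp_div_less)
    have "(?V * mat_diag (m * k) (\<lambda>i. complex_of_real (?e i)) * mat_adjoint ?V) $$ (i, j) =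
        (\<Sum>l<m * k. if l mod k = i mod k then (if i mod k = j mod k then
          U (i mod k) $$ (i div k, l div k) * d (i mod k) (l div k) * cnj (U (i mod k) $$ (j div k, l div k)) else 0) else 0)"
      using ij by (subst index_diag_conj) (auto intro!: sum.cong)
    also have "\<dots> = (if i mod k = j mod k then
        (\<Sum>a<m. U (i mod k) $$ (i div k, a) * d (i mod k) a * cnj (U (i mod k) $$ (j div k, a))) else 0)"
      using r by (simp add: sum_residue)
    also have "(\<Sum>a<m. U (i mod k) $$ (i div k, a) * d (i mod k) a * cnj (U (i mod k) $$ (j div k, a))) =
        partial_block m k M (i mod k) (i mod k) $$ (i div k, j div k)"
      unfolding U(2)[OF r(1)] using r Uc(1)[OF r(1)] by (intro index_diag_conj[symmetric]) auto
    also have "\<dots> = M $$ (i, j div k * k + i mod k)" using r by (simp add: partial_block_def)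
    finally show "dephase_second k M $$ (i, j) =
        (?V * mat_diag (m * k) (\<lambda>i. complex_of_real (?e i)) * mat_adjoint ?V) $$ (i, j)"
      using ij M by (simp add: dephase_second_def)
  qed (use M in \<open>auto simp: dephase_second_def\<close>)
  ultimately show ?thesis unfolding diagonalizes_def by (rule conjI)
qed

text \<open>Dephasing is the sum of the compressions of \<open>M\<close> to the residue classes, so
  its form at \<open>v\<close> is the sum of the forms of \<open>M\<close> at the components of
  \<open>v\<close>.\<close>

lemma psd_dephase_second:
  assumes "psd (m * k) M"
  shows "psd (m * k) (dephase_second k M)"
  unfolding psd_iff_quad_form
proof (intro conjI allI)
  note c = psd_carrier[OF assms]
  show "dephase_second k M \<in> carrier_mat (m * k) (m * k)" using c by simp
  fix v
  have "quad_form (m * k) (dephase_second k M) v = (\<Sum>b<k. quad_form (m * k) M (\<lambda>i. if i mod k = b then v i else 0))"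
  proof -
    have "(\<Sum>b<k. quad_form (m * k) M (\<lambda>i. if i mod k = b then v i else 0)) =
      (\<Sum>i<m * k. \<Sum>j<m * k. \<Sum>b<k. if b = i mod k then (if j mod k = i mod k then cnj (v i) * M $$ (i, j) * v j else 0) else 0)"
    proof -
      have swap: "(\<Sum>b<k. \<Sum>i<m * k. \<Sum>j<m * k. f b i j) = (\<Sum>i<m * k. \<Sum>j<m * k. \<Sum>b<k. f b i j)"
        for f :: "nat \<Rightarrow> nat \<Rightarrow> nat \<Rightarrow> complex"
        by (subst sum.swap, rule sum.cong[OF refl], rule sum.swap)
      show ?thesis unfolding quad_form_def swap by (intro sum.cong refl) auto
    qed
    also have "\<dots> = quad_form (m * k) (dephase_second k M) v"
      unfolding quad_form_def
    proof (intro sum.cong refl)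
      fix i j assume ij: "i \<in> {..<m * k}" "j \<in> {..<m * k}"
      then have "i mod k < k" by (cases "k = 0") auto
      then show "(\<Sum>b<k. if b = i mod k then (if j mod k = i mod k then cnj (v i) * M $$ (i, j) * v j else 0) else 0) =
          cnj (v i) * dephase_second k M $$ (i, j) * v j"
        using ij c by (simp add: dephase_second_def)
    qed
    finally show ?thesis by simp
  qed
  then show "0 \<le> quad_form (m * k) (dephase_second k M) v"
    using assms by (auto simp: psd_iff_quad_form intro!: sum_nonneg)
qed

text \<open>The form of \<open>M\<close> at the component \<open>vb b\<close> equals the pairing of
  \<open>vb b\<close> with the image of \<open>v\<close> under the dephased matrix, which is 0. By
  positivity \<open>M\<close> kills every component, and the components sum to
  \<open>v\<close>.\<close>

lemma mat_kernel_dephase_second: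
  assumes "psd (m * k) M"
  shows "mat_kernel (dephase_second k M) \<subseteq> mat_kernel M"
proof (subst mat_kernel_subset_iff[of _ "m * k"], goal_cases)
  case 3
  note c = psd_carrier[OF assms]
  show ?case
  proof (intro allI impI)
    fix v i assume *: "\<forall>i<m * k. (\<Sum>j<m * k. dephase_second k M $$ (i, j) * v j) = 0" and i: "i < m * k"
    define vb where "vb b j = (if j mod k = b then v j else 0)" for b j
    have "quad_form (m * k) M (vb b) = 0" for b
    proof -
      have "quad_form (m * k) M (vb b) =
          (\<Sum>i<m * k. cnj (vb b i) * (\<Sum>j<m * k. dephase_second k M $$ (i, j) * v j))"
        unfolding quad_form_def sum_distrib_left
        using c by (intro sum.cong refl) (auto simp: vb_def dephase_second_def)
      then show ?thesis using * by simp
    qed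
    from psd_quad_form_zero[OF assms this i]
    have "(\<Sum>b<k. \<Sum>j<m * k. M $$ (i, j) * vb b j) = 0" by simp
    moreover have "(\<Sum>b<k. vb b j) = v j" if "j < m * k" for j
    proof -
      have "j mod k < k" using that by (cases "k = 0") auto
      then show ?thesis by (simp add: vb_def)
    qed
    ultimately show "(\<Sum>j<m * k. M $$ (i, j) * v j) = 0"
      by (subst (asm) sum.swap) (simp add: sum_distrib_left[symmetric])
  qed
qed (use psd_carrier[OF assms] in auto)

text \<open>The spectrum of the dephased matrix is the union of the spectra of the blocks. Its
  logarithm is again block diagonal, so its pairing with \<open>M\<close> sees only the diagonal
  blocks of \<open>M\<close>.\<close>

lemma entropy_dephase_second:
  assumes "psd (m * k) M"
  shows "entropy (dephase_second k M) = (\<Sum>b<k. entropy (partial_block m k M b b))"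
    and "Re (mat_trace (M * mat_log2 (dephase_second k M))) = - entropy (dephase_second k M)"
proof -
  note c = psd_carrier[OF assms]
  have "\<exists>U d. diagonalizes m U d (partial_block m k M b b)" if "b < k" for b
    using psd_diagonalizable[OF psd_partial_block[OF assms that]] by metis
  then obtain U d where d: "\<And>b. b < k \<Longrightarrow> diagonalizes m (U b) (d b) (partial_block m k M b b)"
    by metis
  define V where "V = mat (m * k) (m * k) (\<lambda>(i, j). if i mod k = j mod k then U (i mod k) $$ (i div k, j div k) else 0)"
  have D: "diagonalizes (m * k) V (\<lambda>i. d (i mod k) (i div k)) (dephase_second k M)"
    unfolding V_def by (rule diagonalizes_dephase_second[OF c d])
  have "entropy (dephase_second k M) = - (\<Sum>a<m. \<Sum>b<k. d b a * log 2 (d b a))"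
    unfolding entropy_eq[OF D] sum_lessThan_mult
    by (intro arg_cong[where f = uminus] sum.cong refl) auto
  also have "\<dots> = (\<Sum>b<k. - (\<Sum>a<m. d b a * log 2 (d b a)))"
    by (subst sum.swap) (simp add: sum_negf)
  finally show "entropy (dephase_second k M) = (\<Sum>b<k. entropy (partial_block m k M b b))"
    using entropy_eq[OF d] by simp
  define L where "L = mat_log2 (dephase_second k M)"
  have Lc: "L \<in> carrier_mat (m * k) (m * k)" by (simp add: L_def mat_log2_eq[OF D] V_def)
  have L: "L $$ (j, i) = 0" if "i < m * k" "j < m * k" "i mod k \<noteq> j mod k" for i j
  proof -
    have "L $$ (j, i) = (\<Sum>l<m * k. V $$ (j, l) * complex_of_real (log 2 (d (l mod k) (l div k))) * cnj (V $$ (i, l)))"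
      unfolding L_def mat_log2_eq[OF D] by (rule index_diag_conj) (use that in \<open>auto simp: V_def\<close>)
    then show ?thesis using that by (auto simp: V_def intro!: sum.neutral)
  qed
  have "mat_trace (M * L) = mat_trace (dephase_second k M * L)"
    using c Lc L unfolding mat_trace_mult[OF c Lc] mat_trace_mult[OF dephase_second_carrier[OF c] Lc]
    by (intro sum.cong refl) (auto simp: dephase_second_def)
  then show "Re (mat_trace (M * mat_log2 (dephase_second k M))) = - entropy (dephase_second k M)"
    by (simp add: entropy_def L_def)
qed

section \<open>Splitting and scaling of the coherence\<close>

text \<open>Insert the entropy of the dephased matrix between the two entropies in
  \<open>coherence M\<close>. Complete dephasing acts within the blocks, so the first difference is
  a sum over blocks; the second is the relative entropy.\<close>

lemma coherence_decomposition:
  assumes "psd (m * k) M"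
  shows "coherence M = (\<Sum>b<k. coherence (partial_block m k M b b)) +
    Re (mat_trace (M * mat_log2 M) - mat_trace (M * mat_log2 (dephase_second k M)))"
proof -
  define h where "h x = x * log 2 x" for x :: real
  have "entropy (dephase M) = - (\<Sum>a<m. \<Sum>b<k. h (Re (M $$ (a * k + b, a * k + b))))"
    unfolding entropy_dephase[OF assms] sum_lessThan_mult h_def ..
  also have "\<dots> = (\<Sum>b<k. - (\<Sum>a<m. h (Re (M $$ (a * k + b, a * k + b)))))"
    by (subst sum.swap) (simp add: sum_negf)
  also have "\<dots> = (\<Sum>b<k. entropy (dephase (partial_block m k M b b)))"
  proof (intro sum.cong refl)
    fix b assume "b \<in> {..<k}"
    then have "psd m (partial_block m k M b b)" using psd_partial_block[OF assms] by simp
    from entropy_dephase[OF this]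
    show "- (\<Sum>a<m. h (Re (M $$ (a * k + b, a * k + b)))) = entropy (dephase (partial_block m k M b b))"
      by (simp add: h_def partial_block_def)
  qed
  finally show ?thesis
    using entropy_dephase_second[OF assms]
    by (simp add: coherence_def sum_subtractf entropy_def[of M])
qed

text \<open>Scaling adds to each of the two entropies the term \<open>- c * log 2 c\<close> times
  the trace. Dephasing keeps the trace, so these terms cancel.\<close>

lemma coherence_smult:
  assumes A: "psd n A" and c: "0 < c"
  shows "coherence (complex_of_real c \<cdot>\<^sub>m A) = c * coherence A"
proof -
  note Ac = psd_carrier[OF A]
  have h: "(c * x) * log 2 (c * x) = c * (x * log 2 x) + c * log 2 c * x" if "0 \<le> x" for x :: real
    using that c by (cases "x = 0") (simp_all add: log_mult algebra_simps)
  obtain U d where d: "diagonalizes n U d A" and nn: "\<And>i. i < n \<Longrightarrow> 0 \<le> d i"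
    using psd_diagonalizable[OF A] by blast
  note Ud = diagonalizesD[OF d]
  have "complex_of_real c \<cdot>\<^sub>m A = U * (complex_of_real c \<cdot>\<^sub>m mat_diag n (\<lambda>i. complex_of_real (d i))) * mat_adjoint U"
    by (subst Ud(2)) (use unitary_matD(1,2)[OF Ud(1)] in
      \<open>simp add: mult_smult_distrib[of _ n n _ n] mult_smult_assoc_mat[of _ n n _ n]\<close>)
  also have "complex_of_real c \<cdot>\<^sub>m mat_diag n (\<lambda>i. complex_of_real (d i)) = mat_diag n (\<lambda>i. complex_of_real (c * d i))"
    by (intro eq_matI) auto
  finally have cd: "diagonalizes n U (\<lambda>i. c * d i) (complex_of_real c \<cdot>\<^sub>m A)"
    using Ud(1) unfolding diagonalizes_def by blast
  have "psd n (complex_of_real c \<cdot>\<^sub>m A)"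
    using diag_conj_psd[OF unitary_matD(1)[OF Ud(1)], of "\<lambda>i. c * d i"] nn c
    unfolding diagonalizesD(2)[OF cd] by simp
  note ed = entropy_dephase[OF this]
  have r: "0 \<le> Re (A $$ (i, i))" if "i < n" for i
    using psd_diag_nonneg[OF A that] by (simp add: less_eq_complex_def)
  have "mat_trace A = complex_of_real (\<Sum>i<n. d i)"
    by (subst Ud(2), subst mat_trace_unitary_conj[OF Ud(1)]) (simp_all add: mat_trace_def)
  then have "Re (mat_trace A) = (\<Sum>i<n. d i)" by simp
  then have tr: "(\<Sum>i<n. Re (A $$ (i, i))) = (\<Sum>i<n. d i)"
    using Ac by (simp add: mat_trace_def)
  have "entropy (complex_of_real c \<cdot>\<^sub>m A) = - (c * (\<Sum>i<n. d i * log 2 (d i)) + c * log 2 c * (\<Sum>i<n. d i))"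
    unfolding entropy_eq[OF cd] sum_distrib_left using nn by (simp add: h sum.distrib)
  moreover have "entropy (dephase (complex_of_real c \<cdot>\<^sub>m A)) =
      - (c * (\<Sum>i<n. Re (A $$ (i, i)) * log 2 (Re (A $$ (i, i)))) + c * log 2 c * (\<Sum>i<n. Re (A $$ (i, i))))"
    unfolding ed sum_distrib_left using Ac r by (simp add: h sum.distrib)
  ultimately show ?thesis
    unfolding coherence_def entropy_eq[OF d] entropy_dephase[OF A]
    by (simp add: tr algebra_simps)
qed

text \<open>Covers the blocks of probability 0, which cannot be normalized: all their eigenvalues
  and diagonal entries are 0.\<close>

lemma coherence_trace_zero:
  assumes A: "psd n A" and tr: "mat_trace A = 0"
  shows "coherence A = 0"
proof -
  note Ac = psd_carrier[OF A]
  obtain U d where d: "diagonalizes n U d A" and nn: "\<And>i. i < n \<Longrightarrow> 0 \<le> d i"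
    using psd_diagonalizable[OF A] by blast
  note Ud = diagonalizesD[OF d]
  have "mat_trace A = complex_of_real (\<Sum>i<n. d i)"
    by (subst Ud(2), subst mat_trace_unitary_conj[OF Ud(1)]) (simp_all add: mat_trace_def)
  then have "(\<Sum>i<n. d i) = 0" using tr by (metis of_real_eq_0_iff)
  then have 1: "\<forall>i\<in>{..<n}. d i = 0"
    by (subst (asm) sum_nonneg_eq_0_iff) (use nn in auto)
  have "(\<Sum>i<n. Re (A $$ (i, i))) = 0"
    using tr Ac by (simp add: mat_trace_def flip: Re_sum)
  then have 2: "\<forall>i\<in>{..<n}. Re (A $$ (i, i)) = 0"
    by (subst (asm) sum_nonneg_eq_0_iff) (use psd_diag_nonneg[OF A] in \<open>auto simp: less_eq_complex_def\<close>)
  show ?thesis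
    unfolding coherence_def entropy_eq[OF d] entropy_dephase[OF A] using 1 2 by simp
qed

lemma tensor_id_coherence_gain_le:
  assumes \<Phi>: "quantum_channel m n \<Phi>" and k: "1 \<le> k" and \<rho>: "psd (m * k) \<rho>"
  shows "coherence (tensor_id m n k \<Phi> \<rho>) - coherence \<rho> \<le>
    (\<Sum>b<k. coherence (\<Phi> (partial_block m k \<rho> b b)) - coherence (partial_block m k \<rho> b b))"
proof -
  have lin: "linear_superop m n \<Phi>" using \<Phi> by (simp add: quantum_channel_def)
  note \<Psi> = quantum_channel_tensor_id[OF \<Phi> k]
  note \<rho>' = quantum_channel_psd[OF \<Psi> \<rho>]
  note deph = tensor_id_dephase_second[OF lin psd_carrier[OF \<rho>]]
  have "Re (mat_trace (tensor_id m n k \<Phi> \<rho> * mat_log2 (tensor_id m n k \<Phi> \<rho>)) -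
      mat_trace (tensor_id m n k \<Phi> \<rho> * mat_log2 (dephase_second k (tensor_id m n k \<Phi> \<rho>)))) \<le>
    Re (mat_trace (\<rho> * mat_log2 \<rho>) - mat_trace (\<rho> * mat_log2 (dephase_second k \<rho>)))"
    using relative_entropy_mono[OF \<Psi> \<rho> psd_dephase_second[OF \<rho>] \<rho>'] psd_dephase_second[OF \<rho>']
      mat_kernel_dephase_second[OF \<rho>] mat_kernel_dephase_second[OF \<rho>'] by (simp add: deph)
  then show ?thesis
    using coherence_decomposition[OF \<rho>] coherence_decomposition[OF \<rho>']
    by (simp add: partial_block_tensor_id[OF lin] sum_subtractf)
qed

lemma exists_state_coherence_gain_ge:
  assumes \<Phi>: "quantum_channel m n \<Phi>" and k: "1 \<le> k" and \<rho>: "\<rho> \<in> states (m * k)"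
  obtains \<tau> where "\<tau> \<in> states m"
    "coherence (tensor_id m n k \<Phi> \<rho>) - coherence \<rho> \<le> coherence (\<Phi> \<tau>) - coherence \<tau>"
proof -
  have psd: "psd (m * k) \<rho>" and tr: "mat_trace \<rho> = 1" using \<rho> by (auto simp: states_def)
  define B where "B b = partial_block m k \<rho> b b" for b
  define p where "p b = Re (mat_trace (B b))" for b
  define g where "g b = coherence (\<Phi> (B b)) - coherence (B b)" for b
  define G where "G = coherence (tensor_id m n k \<Phi> \<rho>) - coherence \<rho>"
  have Bp: "psd m (B b)" if "b < k" for b using psd_partial_block[OF psd that] by (simp add: B_def)
  have p: "0 \<le> p b" "mat_trace (B b) = complex_of_real (p b)" if "b < k" for b
    using psd_trace_nonneg[OF Bp[OF that]] by (simp_all add: p_def less_eq_complex_def complex_eq_iff)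
  have "(\<Sum>b<k. p b) = 1"
    using tr mat_trace_blocks[OF psd_carrier[OF psd]] by (simp add: p_def B_def flip: Re_sum)
  \<comment> \<open>The block traces are probabilities, so the total gain is written as their
    average in order to be compared term by term.\<close>
  then have "(\<Sum>b<k. p b * G) = G" by (simp add: sum_distrib_right[symmetric])
  also have "G \<le> (\<Sum>b<k. g b)"
    using tensor_id_coherence_gain_le[OF \<Phi> k psd] by (simp add: G_def g_def B_def)
  finally have le: "(\<Sum>b<k. p b * G) \<le> (\<Sum>b<k. g b)" .
  have zero: "g b = 0" if "b < k" "p b = 0" for b
  proof -
    have "mat_trace (B b) = 0" using p(2)[OF that(1)] that(2) by simp
    then show ?thesis
      using coherence_trace_zero[OF Bp[OF that(1)]] quantum_channelD(4)[OF \<Phi> psd_carrier[OF Bp[OF that(1)]]]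
        coherence_trace_zero[OF quantum_channel_psd[OF \<Phi> Bp[OF that(1)]]]
      by (simp add: g_def)
  qed
  \<comment> \<open>Blocks of probability 0 contribute 0 to both sums, so failure at every other
    block would make the inequality between the sums strict the wrong way. The chosen
    \<open>p b\<close> has to be nonzero because it is divided by.\<close>
  have "\<exists>b<k. p b \<noteq> 0 \<and> p b * G \<le> g b"
  proof (rule ccontr)
    assume no: "\<not> (\<exists>b<k. p b \<noteq> 0 \<and> p b * G \<le> g b)"
    have "\<exists>b<k. p b \<noteq> 0"
      using \<open>(\<Sum>b<k. p b) = 1\<close> by (metis lessThan_iff sum.neutral zero_neq_one)
    then obtain b where "b < k" "p b \<noteq> 0" by blast
    then have "(\<Sum>b<k. g b) < (\<Sum>b<k. p b * G)"
      using no zero by (intro sum_strict_mono_ex1) (force simp: not_le)+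
    with le show False by simp
  qed
  then obtain b where b: "b < k" "p b \<noteq> 0" "p b * G \<le> g b" by blast
  then have pos: "0 < p b" using p(1)[of b] by simp
  define \<tau> where "\<tau> = complex_of_real (1 / p b) \<cdot>\<^sub>m B b"
  note Bb = Bp[OF b(1)]
  have "psd m \<tau>"
    unfolding psd_iff_quad_form
  proof (intro conjI allI)
    show "\<tau> \<in> carrier_mat m m" using psd_carrier[OF Bb] by (simp add: \<tau>_def)
    fix v
    have "quad_form m \<tau> v = complex_of_real (1 / p b) * quad_form m (B b) v"
      using psd_carrier[OF Bb] by (simp add: quad_form_def \<tau>_def sum_distrib_left mult_ac)
    then show "0 \<le> quad_form m \<tau> v"
      using Bb pos by (simp add: psd_iff_quad_form less_eq_complex_def)
  qed
  moreover have "mat_trace \<tau> = 1"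
    using b(2) p(2)[OF b(1)] psd_carrier[OF Bb] by (simp add: \<tau>_def mat_trace_smult[of _ m])
  ultimately have "\<tau> \<in> states m" by (simp add: states_def)
  moreover have "\<Phi> \<tau> = complex_of_real (1 / p b) \<cdot>\<^sub>m \<Phi> (B b)"
    unfolding \<tau>_def using quantum_channelD(3)[OF \<Phi> psd_carrier[OF Bb]] .
  then have "coherence (\<Phi> \<tau>) - coherence \<tau> = 1 / p b * g b"
    using coherence_smult[OF Bb, of "1 / p b"] coherence_smult[OF quantum_channel_psd[OF \<Phi> Bb], of "1 / p b"] pos
    by (simp add: \<tau>_def g_def diff_divide_distrib)
  then have "G \<le> coherence (\<Phi> \<tau>) - coherence \<tau>"
    using b(3) pos by (simp add: pos_le_divide_eq mult.commute)
  ultimately show ?thesis using that by (simp add: G_def)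
qed

lemma quantum_channel_states:
  assumes "quantum_channel m n \<Phi>" "\<rho> \<in> states m"
  shows "\<Phi> \<rho> \<in> states n"
  using assms quantum_channel_psd[OF assms(1)] quantum_channelD(4)[OF assms(1)] psd_carrier
  by (auto simp: states_def)

text \<open>Both coherences of states are finite, so the subtraction of extended reals is the
  ordinary one.\<close>

lemma rel_entropy_coherence_gain:
  assumes "quantum_channel m n \<Phi>" "\<rho> \<in> states m"
  shows "rel_entropy_coherence (\<Phi> \<rho>) - rel_entropy_coherence \<rho> = ereal (coherence (\<Phi> \<rho>) - coherence \<rho>)"
  using rel_entropy_coherence_eq[OF assms(2)] rel_entropy_coherence_eq[OF quantum_channel_states[OF assms]]
  by simp

theorem theorem1:
  fixes dA dA' :: nat and \<Phi> :: "complex mat \<Rightarrow> complex mat"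
  assumes "quantum_channel dA dA' \<Phi>"
  shows "generalized_cohering_power dA \<Phi> = complete_cohering_power dA dA' \<Phi>"
proof (rule antisym)
  show "generalized_cohering_power dA \<Phi> \<le> complete_cohering_power dA dA' \<Phi>"
    unfolding generalized_cohering_power_def
  proof (rule SUP_least)
    fix \<rho> assume \<rho>: "\<rho> \<in> states dA"
    \<comment> \<open>The trivial ancilla \<open>k = 1\<close> already realizes every gain of
      \<open>\<Phi>\<close>.\<close>
    then have "tensor_id dA dA' 1 \<Phi> \<rho> = \<Phi> \<rho>"
      using assms by (intro tensor_id_one) (auto simp: quantum_channel_def states_def psd_def)
    then show "rel_entropy_coherence (\<Phi> \<rho>) - rel_entropy_coherence \<rho> \<le> complete_cohering_power dA dA' \<Phi>"
      unfolding complete_cohering_power_def using \<rho>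
      by (intro SUP_upper2[of 1] SUP_upper2[of \<rho>]) auto
  qed
  show "complete_cohering_power dA dA' \<Phi> \<le> generalized_cohering_power dA \<Phi>"
    unfolding complete_cohering_power_def
  proof (intro SUP_least)
    fix k \<rho> assume k: "k \<in> {1::nat..}" and \<rho>: "\<rho> \<in> states (dA * k)"
    \<comment> \<open>Each choice of \<open>k\<close> and \<open>\<rho>\<close> has its own
      dominating \<open>\<tau>\<close>, so the suprema are compared without being attained.\<close>
    then obtain \<tau> where \<tau>: "\<tau> \<in> states dA"
      "coherence (tensor_id dA dA' k \<Phi> \<rho>) - coherence \<rho> \<le> coherence (\<Phi> \<tau>) - coherence \<tau>"
      using exists_state_coherence_gain_ge[OF assms] by auto
    have "rel_entropy_coherence (tensor_id dA dA' k \<Phi> \<rho>) - rel_entropy_coherence \<rho> \<le>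
        rel_entropy_coherence (\<Phi> \<tau>) - rel_entropy_coherence \<tau>"
      using rel_entropy_coherence_gain[OF quantum_channel_tensor_id[OF assms] \<rho>] k
        rel_entropy_coherence_gain[OF assms \<tau>(1)] \<tau>(2) by simp
    also have "\<dots> \<le> generalized_cohering_power dA \<Phi>"
      unfolding generalized_cohering_power_def using \<tau>(1) by (rule SUP_upper)
    finally show "rel_entropy_coherence (tensor_id dA dA' k \<Phi> \<rho>) - rel_entropy_coherence \<rho> \<le>
      generalized_cohering_power dA \<Phi>" .
  qed
qed

end
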